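(* Let $N\geq 2$, $g\in C^1(\mathbb{R})$, and let $u$ be a radial solution (not necessarily bounded) of $-\Delta u=g(u)$ in $\mathbb{R}^N$ which is stable outside a compact set. Then $u$ satisfies either $(L)$ or $(S)$, where: $(L)$ There exist $M>0$ and $r_0\geq 1$ such that - $|u(r)|\geq M r^{-N/2+\sqrt{N-1}+2}$ for all $r\geq r_0$, if $2\leq N\leq 9$; - $|u(r)|\geq M\log(r)$ for all $r\geq r_0$, if $N=10$; - $|u(r)-u_\infty|\geq M r^{-N/2+\sqrt{N-1}+2}$ for all $r\geq r_0$, if $N\geq 11$. $(S)$ There exists $M>0$ such that - $|u(r)|\leq M\log(r)$ for all $r\geq 2$, if $N=2$; - $|u(r)-u_\infty|\leq M r^{-N/2-\sqrt{N-1}+2}$ for all $r\geq 1$, if $N\geq 3$.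
   Context: Solutions are classical: $u\in C^2(\mathbb{R}^N)$. A solution $u$ of $-\Delta u=g(u)$ in $\mathbb{R}^N$ is stable outside a compact set if there exists a compact set $K\subset\mathbb{R}^N$ such that $\int_{\mathbb{R}^N}\left(|\nabla v|^2-g'(u)v^2\right)dx\geq 0$ for every $v\in C^1(\mathbb{R}^N)$ with compact support in $\mathbb{R}^N\setminus K$. For radial $u$ one writes $u(r)$ for $u(x)$ with $r=|x|$. The symbol $u_\infty$ denotes $\lim_{r\to\infty}u(r)\in[-\infty,+\infty]$; a condition in which $u_\infty$ appears is understood to include the existence of this limit. For $N\geq 11$, if $u_\infty=\pm\infty$ the inequality in $(L)$ is vacuous (trivially true); for $N\geq 3$, condition $(S)$ implicitly says that $u_\infty\in\mathbb{R}$. *)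

theory Defs
  imports "HOL-Analysis.Analysis"
begin

definition partial_deriv :: "'n::finite \<Rightarrow> (real^'n \<Rightarrow> real) \<Rightarrow> real^'n \<Rightarrow> real" where
  "partial_deriv i f x = frechet_derivative f (at x) (axis i 1)"

definition C1_fun :: "(real^'n::finite \<Rightarrow> real) \<Rightarrow> bool" where
  "C1_fun f \<longleftrightarrow> f differentiable_on UNIV \<and> (\<forall>i. continuous_on UNIV (partial_deriv i f))"

definition C2_fun :: "(real^'n::finite \<Rightarrow> real) \<Rightarrow> bool" where
  "C2_fun f \<longleftrightarrow> C1_fun f \<and> (\<forall>i. C1_fun (partial_deriv i f))"

definition grad :: "(real^'n::finite \<Rightarrow> real) \<Rightarrow> real^'n \<Rightarrow> real^'n" where
  "grad f x = (\<chi> i. partial_deriv i f x)"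

definition laplacian :: "(real^'n::finite \<Rightarrow> real) \<Rightarrow> real^'n \<Rightarrow> real" where
  "laplacian f x = (\<Sum>i\<in>UNIV. partial_deriv i (partial_deriv i f) x)"

definition classical_solution :: "(real \<Rightarrow> real) \<Rightarrow> (real^'n::finite \<Rightarrow> real) \<Rightarrow> bool" where
  "classical_solution g u \<longleftrightarrow> C2_fun u \<and> (\<forall>x. - laplacian u x = g (u x))"

text \<open>The integrand below is continuous with compact support whenever \<open>g\<close> is of class
  \<open>C\<^sup>1\<close> and \<open>u\<close> is continuous, so the Bochner integral never takes its default value.\<close>

definition stable_outside_compact :: "(real \<Rightarrow> real) \<Rightarrow> (real^'n::finite \<Rightarrow> real) \<Rightarrow> bool" where
  "stable_outside_compact g u \<longleftrightarrow>
     (\<exists>K. compact K \<and>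
       (\<forall>v. C1_fun v \<and> compact (closure {x. v x \<noteq> 0}) \<and> closure {x. v x \<noteq> 0} \<subseteq> - K \<longrightarrow>
          (LINT x|lborel. (norm (grad v x))\<^sup>2 - deriv g (u x) * (v x)\<^sup>2) \<ge> 0))"

definition radial :: "(real^'n::finite \<Rightarrow> real) \<Rightarrow> bool" where
  "radial u \<longleftrightarrow> (\<forall>x y. norm x = norm y \<longrightarrow> u x = u y)"

text \<open>For radial \<open>u\<close> and \<open>r \<ge> 0\<close> the value does not depend on the chosen point;
  for \<open>r < 0\<close> it is meaningless.\<close>

definition radial_profile :: "(real^'n::finite \<Rightarrow> real) \<Rightarrow> real \<Rightarrow> real" where
  "radial_profile u r = u (SOME x. norm x = r)"

definition has_limit_at_infinity :: "(real \<Rightarrow> real) \<Rightarrow> ereal \<Rightarrow> bool" where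
  "has_limit_at_infinity w l \<longleftrightarrow> ((\<lambda>r. ereal (w r)) \<longlongrightarrow> l) at_top"

text \<open>In the two conditions \<open>w\<close> is the radial profile of the solution. The differences with the
  limit \<open>l\<close> are taken in the extended reals: for \<open>l = \<plusminus>\<infinity>\<close> their absolute value is \<open>\<infinity>\<close>, so the lower
  bound in the first condition is trivially true and the upper bound in the second one is false,
  that is, the second condition forces the limit to be finite.\<close>

definition condition_L :: "nat \<Rightarrow> (real \<Rightarrow> real) \<Rightarrow> bool" where
  "condition_L N w \<longleftrightarrow>
     (\<exists>M>0. \<exists>r0\<ge>1.
        (2 \<le> N \<and> N \<le> 9 \<longrightarrow>
           (\<forall>r\<ge>r0. \<bar>w r\<bar> \<ge> M * r powr (- real N / 2 + sqrt (real N - 1) + 2))) \<and>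
        (N = 10 \<longrightarrow> (\<forall>r\<ge>r0. \<bar>w r\<bar> \<ge> M * ln r)) \<and>
        (N \<ge> 11 \<longrightarrow>
           (\<exists>l. has_limit_at_infinity w l \<and>
              (\<forall>r\<ge>r0. \<bar>ereal (w r) - l\<bar> \<ge>
                 ereal (M * r powr (- real N / 2 + sqrt (real N - 1) + 2))))))"

definition condition_S :: "nat \<Rightarrow> (real \<Rightarrow> real) \<Rightarrow> bool" where
  "condition_S N w \<longleftrightarrow>
     (\<exists>M>0.
        (N = 2 \<longrightarrow> (\<forall>r\<ge>2. \<bar>w r\<bar> \<le> M * ln r)) \<and>
        (N \<ge> 3 \<longrightarrow>
           (\<exists>l. has_limit_at_infinity w l \<and>
              (\<forall>r\<ge>1. \<bar>ereal (w r) - l\<bar> \<le>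
                 ereal (M * r powr (- real N / 2 - sqrt (real N - 1) + 2))))))"

end

theory Submission
  imports Defs
begin

text \<open>Write \<open>w\<close> for the profile, \<open>z = w'\<close>, \<open>a = sqrt (N - 1)\<close> and \<open>\<phi> = r\<^bsup>N-1\<^esup> z\<^sup>2\<close>. Since \<open>z\<close> solves the
  linearised equation with the additional term \<open>(N - 1) z / r\<^sup>2\<close>, testing stability with \<open>z \<eta>\<close> gives the
  Hardy type inequality \<open>a\<^sup>2 \<integral> \<phi> \<eta>\<^sup>2 / r\<^sup>2 \<le> \<integral> \<phi> \<eta>'\<^sup>2\<close> for \<open>\<eta>\<close> supported near infinity. Let \<open>B s\<close> be the infimum
  of \<open>\<integral> \<phi> (\<eta>'\<^sup>2 - a\<^sup>2 \<eta>\<^sup>2 / r\<^sup>2)\<close> over \<open>[s, \<infinity>)\<close> among compactly supported \<open>\<eta>\<close> with \<open>\<eta> s = 1\<close>; it is finite by the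
  inequality. Gluing the powers \<open>r\<^bsup>-a\<^esup>\<close> and \<open>r\<^bsup>a\<^esup>\<close>, whose energy density vanishes, to near-optimal \<open>\<eta>\<close> yields a
  dichotomy. If \<open>B\<close> is positive somewhere, then it grows at least like \<open>r\<^bsup>2a\<^esup>\<close>, hence
  \<open>\<integral> 1 / \<phi>\<close> over \<open>[r, 2r]\<close> is at most of order \<open>r\<^bsup>-2a\<^esup>\<close>, which forces \<open>z \<noteq> 0\<close> and bounds \<open>\<bar>w (2r) - w r\<bar>\<close> from
  below. Otherwise \<open>0 \<le> - B s\<close> is at most of order \<open>s\<^bsup>-2a\<^esup>\<close>, and testing with lower powers of \<open>r\<close> turns this
  into weighted bounds on \<open>\<integral> \<phi>\<close> and so on \<open>\<bar>w t - w s\<bar>\<close>.\<close>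

subsection \<open>Extending a quadratic inequality to Lipschitz test functions\<close>

lemma lipschitz_on_has_real_derivative:
  fixes f :: "real \<Rightarrow> real"
  assumes "\<And>x. x \<in> {a..b} \<Longrightarrow> (f has_real_derivative f' x) (at x within {a..b})"
    and "continuous_on {a..b} f'"
  shows "\<exists>L. L-lipschitz_on {a..b} f"
proof -
  have "bounded (f' ` {a..b})"
    using assms(2) by (intro compact_imp_bounded compact_continuous_image) auto
  then obtain C where "C > 0" and C: "\<And>x. x \<in> {a..b} \<Longrightarrow> \<bar>f' x\<bar> \<le> C"
    by (auto simp: bounded_pos)
  have "C-lipschitz_on {a..b} f"
  proof (rule bounded_derivative_imp_lipschitz)
    show "(f has_derivative (\<lambda>h. h * f' x)) (at x within {a..b})" if "x \<in> {a..b}" for x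
      using assms(1)[OF that] by (simp add: has_field_derivative_def mult.commute[of _ "f' x"])
    show "onorm (\<lambda>h. h * f' x) \<le> C" if "x \<in> {a..b}" for x
      using C[OF that] by (intro onorm_bound) (auto simp: abs_mult mult.commute[of _ "\<bar>f' x\<bar>"] intro!: mult_right_mono)
  qed (use \<open>C > 0\<close> in auto)
  then show ?thesis ..
qed

text \<open>A right derivative sees only the values on \<open>[x, b)\<close>, so piecewise
  definitions can be differentiated at their break points without matching the slopes.\<close>

lemma has_real_derivative_right_cong:
  fixes f :: "real \<Rightarrow> real"
  assumes "(f has_real_derivative D) (at_right x)" "x < b" "\<And>y. x \<le> y \<Longrightarrow> y < b \<Longrightarrow> f y = g y"
  shows "(g has_real_derivative D) (at_right x)"
proof -
  have "\<forall>\<^sub>F y in at_right x. f y = g y"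
    unfolding eventually_at_right_field using assms by (intro exI[of _ b]) auto
  then show ?thesis
    using has_field_derivative_cong_eventually[of f g x "{x<..}" D] assms by simp
qed

lemma continuous_antiderivative:
  fixes f :: "real \<Rightarrow> real"
  assumes "continuous_on UNIV f"
  obtains F where "\<And>x. (F has_real_derivative f x) (at x)"
proof -
  have "\<exists>F. \<forall>x :: real. -\<infinity> < ereal x \<longrightarrow> ereal x < \<infinity> \<longrightarrow> (F has_vector_derivative f x) (at x)"
    using assms by (intro einterval_antiderivative) (auto simp: continuous_on_eq_continuous_at)
  then show ?thesis
    using that by (auto simp: has_real_derivative_iff_has_vector_derivative)
qed

text \<open>Steklov averages \<open>n (G (x + 1/n) - G x)\<close>, with \<open>G' = H\<close>, are \<open>C\<^sup>1\<close> and their derivatives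
  are difference quotients of \<open>H\<close>, so a right derivative everywhere is all the regularity needed.\<close>

lemma energy_nonneg_lipschitz:
  fixes \<phi> \<psi> :: "real \<Rightarrow> real"
  assumes \<phi>: "continuous_on {R<..} \<phi>" and \<psi>: "continuous_on {R<..} \<psi>"
    and C1: "\<And>c d \<eta> \<eta>'. R < c \<Longrightarrow> c < d \<Longrightarrow> (\<And>x. (\<eta> has_real_derivative \<eta>' x) (at x)) \<Longrightarrow>
        continuous_on UNIV \<eta>' \<Longrightarrow> (\<And>x. x \<notin> {c<..<d} \<Longrightarrow> \<eta> x = 0) \<Longrightarrow>
        integral {c..d} (\<lambda>x. \<phi> x * (\<eta>' x)\<^sup>2 - \<psi> x * (\<eta> x)\<^sup>2) \<ge> 0"
    and cd: "R < c" "c < d"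
    and H: "L-lipschitz_on UNIV H" "\<And>x. x \<notin> {c<..<d} \<Longrightarrow> H x = 0"
    and h: "\<And>x. (H has_real_derivative h x) (at_right x)"
  shows "integral {c..d} (\<lambda>x. \<phi> x * (h x)\<^sup>2 - \<psi> x * (H x)\<^sup>2) \<ge> 0"
proof -
  \<comment> \<open>The averages look ahead by \<open>e n\<close>, so their support sticks out of
    \<open>[c, d]\<close> on the left; \<open>c0\<close> leaves room for this while staying above
    \<open>R\<close>.\<close>
  define c0 where "c0 = (R + c) / 2"
  have c0: "R < c0" "c0 < c"
    using cd by (auto simp: c0_def)
  have contH: "continuous_on UNIV H"
    using H(1) by (rule lipschitz_on_continuous_on)
  obtain G where G: "\<And>x. (G has_real_derivative H x) (at x)"
    using continuous_antiderivative[OF contH] by blast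
  have lip: "\<bar>H x - H y\<bar> \<le> L * \<bar>x - y\<bar>" for x y
    using lipschitz_onD[OF H(1), of x y] by (auto simp: dist_real_def)
  have L: "L \<ge> 0"
    using H(1) by (rule lipschitz_on_nonneg)
  obtain k :: nat where k: "inverse (real (Suc k)) < c - c0"
    using reals_Archimedean[of "c - c0"] c0 by auto
  define e where "e n = inverse (real (Suc (k + n)))" for n
  have e_pos: "e n > 0" for n
    by (simp add: e_def)
  have e_less: "e n < c - c0" for n
  proof -
    have "e n \<le> inverse (real (Suc k))"
      unfolding e_def by (rule le_imp_inverse_le) auto
    then show ?thesis
      using k by linarith
  qed
  have e_lim: "e \<longlonglongrightarrow> 0"
    using LIMSEQ_ignore_initial_segment[OF LIMSEQ_inverse_real_of_nat, of k]
    by (simp add: e_def[abs_def] add_ac)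
  define \<eta> where "\<eta> n x = (G (x + e n) - G x) / e n" for n x
  define \<eta>' where "\<eta>' n x = (H (x + e n) - H x) / e n" for n x
  have mvt: "\<exists>y. x < y \<and> y < x + e n \<and> \<eta> n x = H y" for n x
  proof -
    obtain y where "x < y" "y < x + e n" "G (x + e n) - G x = (x + e n - x) * H y"
      using MVT2[of x "x + e n" G H] G e_pos[of n] by auto
    then show ?thesis
      using e_pos[of n] by (intro exI[of _ y]) (simp add: \<eta>_def)
  qed
  have der: "(\<eta> n has_real_derivative \<eta>' n x) (at x)" for n x
    unfolding \<eta>_def \<eta>'_def
    by (intro DERIV_cdivide DERIV_diff G iffD1[OF DERIV_shift G])
  have cont': "continuous_on UNIV (\<eta>' n)" for n
    unfolding \<eta>'_def using e_pos[of n]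
    by (intro continuous_intros continuous_on_compose2[OF contH]) auto
  have cont: "continuous_on UNIV (\<eta> n)" for n
    using der by (meson DERIV_isCont continuous_at_imp_continuous_on)
  have zero: "\<eta> n x = 0" if "x \<notin> {c0<..<d}" for n x
  proof -
    obtain y where "x < y" "y < x + e n" "\<eta> n x = H y"
      using mvt by blast
    then show ?thesis
      using that e_less[of n] H(2)[of y] by auto
  qed
  have le': "\<bar>\<eta>' n x\<bar> \<le> L" for n x
    using lip[of "x + e n" x] e_pos[of n] by (simp add: \<eta>'_def field_simps)
  have close: "\<bar>\<eta> n x - H x\<bar> \<le> L * e n" for n x
  proof -
    obtain y where y: "x < y" "y < x + e n" "\<eta> n x = H y"
      using mvt by blast
    have "\<bar>H y - H x\<bar> \<le> L * \<bar>y - x\<bar>"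
      by (rule lip)
    also have "\<dots> \<le> L * e n"
      using y L by (intro mult_left_mono) auto
    finally show ?thesis
      using y by simp
  qed
  have bound_H: "\<bar>H x\<bar> \<le> L * (d - c)" for x
  proof (cases "x \<in> {c<..<d}")
    case True
    have "\<bar>H x\<bar> \<le> L * \<bar>x - c\<bar>"
      using lip[of x c] H(2)[of c] by auto
    also have "\<dots> \<le> L * (d - c)"
      using True L by (intro mult_left_mono) auto
    finally show ?thesis .
  qed (use H(2) L cd in auto)
  define B where "B = L * (d - c)"
  have le: "\<bar>\<eta> n x\<bar> \<le> B" for n x
    using mvt[of x n] bound_H by (auto simp: B_def)
  have sub: "{c0..d} \<subseteq> {R<..}"
    using c0 by auto
  note cont_\<phi> = continuous_on_subset[OF \<phi> sub] and cont_\<psi> = continuous_on_subset[OF \<psi> sub]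
  \<comment> \<open>The Lipschitz constant bounds the difference quotients, and together with the
    length of the support also the averages. This gives one majorant for dominated
    convergence.\<close>
  define D where "D x = \<bar>\<phi> x\<bar> * L\<^sup>2 + \<bar>\<psi> x\<bar> * B\<^sup>2" for x
  let ?E = "\<lambda>n x. \<phi> x * (\<eta>' n x)\<^sup>2 - \<psi> x * (\<eta> n x)\<^sup>2"
  let ?e = "\<lambda>x. \<phi> x * (h x)\<^sup>2 - \<psi> x * (H x)\<^sup>2"
  have 1: "?E n integrable_on {c0..d}" for n
    by (intro integrable_continuous_real continuous_intros cont_\<phi> cont_\<psi>
        continuous_on_subset[OF cont] continuous_on_subset[OF cont']) auto
  have 2: "D integrable_on {c0..d}"
    unfolding D_def by (intro integrable_continuous_real continuous_intros cont_\<phi> cont_\<psi>)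
  have 3: "norm (?E n x) \<le> D x" for n x
  proof -
    have "\<bar>\<phi> x\<bar> * (\<eta>' n x)\<^sup>2 \<le> \<bar>\<phi> x\<bar> * L\<^sup>2" "\<bar>\<psi> x\<bar> * (\<eta> n x)\<^sup>2 \<le> \<bar>\<psi> x\<bar> * B\<^sup>2"
      using le'[of n x] le[of n x] L by (auto intro!: mult_left_mono simp: abs_le_square_iff[symmetric])
    moreover have "norm (?E n x) \<le> \<bar>\<phi> x\<bar> * (\<eta>' n x)\<^sup>2 + \<bar>\<psi> x\<bar> * (\<eta> n x)\<^sup>2"
      by (rule order_trans[OF norm_triangle_ineq4]) (simp add: abs_mult)
    ultimately show ?thesis
      unfolding D_def by linarith
  qed
  have 4: "(\<lambda>n. ?E n x) \<longlonglongrightarrow> ?e x" for x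
  proof -
    have "(\<lambda>n. \<eta> n x - H x) \<longlonglongrightarrow> 0"
      by (rule Lim_null_comparison[OF _ tendsto_mult_right_zero[OF e_lim, of L]]) (simp add: close)
    then have "(\<lambda>n. \<eta> n x) \<longlonglongrightarrow> H x"
      by (rule LIM_zero_cancel)
    have lim: "((\<lambda>y. (H y - H x) / (y - x)) \<longlongrightarrow> h x) (at_right x)"
      using h[of x] by (simp add: has_field_derivative_iff)
    \<comment> \<open>\<open>\<eta>' n x\<close> is the difference quotient of \<open>H\<close> at
      \<open>x\<close> with the positive step \<open>e n\<close>, so it tends to the right
      derivative.\<close>
    have "filterlim (\<lambda>n. x + e n) (at_right x) sequentially"
    proof (rule filterlim_at_withinI)
      show "(\<lambda>n. x + e n) \<longlonglongrightarrow> x"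
        using tendsto_add[OF tendsto_const e_lim, of x] by simp
      show "\<forall>\<^sub>F n in sequentially. x + e n \<in> {x<..} - {x}"
        using e_pos by (simp add: less_imp_neq)
    qed
    from filterlim_compose[OF lim this] have "(\<lambda>n. \<eta>' n x) \<longlonglongrightarrow> h x"
      unfolding \<eta>'_def by simp
    with \<open>(\<lambda>n. \<eta> n x) \<longlonglongrightarrow> H x\<close> show ?thesis
      by (intro tendsto_intros)
  qed
  note dom = dominated_convergence[OF 1 2 3 4]
  have "integral {c0..d} ?e \<ge> 0"
  proof (rule LIMSEQ_le_const[OF dom(2)])
    show "\<exists>N. \<forall>n\<ge>N. 0 \<le> integral {c0..d} (?E n)"
      using C1[OF _ _ der cont' zero] c0 cd by auto
  qed
  \<comment> \<open>The strip added on the left contributes nothing in the limit: \<open>H\<close>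
    vanishes there, and so does its right derivative, except possibly at the single point
    \<open>c\<close>.\<close>
  moreover have "integral {c0..c} ?e = 0"
  proof -
    have "?e x = 0" if "x \<in> {c0..c} - {c}" for x
    proof -
      have "((\<lambda>_. 0) has_real_derivative h x) (at_right x)"
        by (rule has_real_derivative_right_cong[OF h[of x], of c]) (use that H(2) in auto)
      then have "h x = 0"
        by (intro has_field_derivative_unique[of "\<lambda>_. 0" _ x "{x<..}"]) auto
      then show ?thesis
        using that H(2)[of x] by auto
    qed
    then have "integral {c0..c} ?e = integral {c0..c} (\<lambda>_. 0)"
      by (intro integral_spike[of "{c}"]) auto
    then show ?thesis
      by simp
  qed
  moreover have "integral {c0..c} ?e + integral {c..d} ?e = integral {c0..d} ?e"
    using dom(1) c0 cd by (intro Henstock_Kurzweil_Integration.integral_combine) auto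
  ultimately show ?thesis
    by simp
qed

subsection \<open>Weights satisfying a Hardy type inequality\<close>

text \<open>\<open>\<phi>\<close> may have zeros, so later bounds on the integral of
  \<open>1 / \<phi>\<close> are stated for positive majorants \<open>p\<close> of
  \<open>\<phi>\<close>. Since \<open>0 \<le> R\<close>, dividing by \<open>x\<^sup>2\<close> is
  safe for \<open>x > R\<close>.\<close>

locale hardy_weight =
  fixes \<phi> :: "real \<Rightarrow> real" and R a :: real
  assumes R_nonneg: "0 \<le> R"
    and a_nonneg: "0 \<le> a"
    and cont: "continuous_on {R<..} \<phi>"
    and nonneg: "\<And>x. R < x \<Longrightarrow> 0 \<le> \<phi> x"
    and C1_ineq: "\<And>c d \<eta> \<eta>'. R < c \<Longrightarrow> c < d \<Longrightarrow> (\<And>x. (\<eta> has_real_derivative \<eta>' x) (at x)) \<Longrightarrow>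
        continuous_on UNIV \<eta>' \<Longrightarrow> (\<And>x. x \<notin> {c<..<d} \<Longrightarrow> \<eta> x = 0) \<Longrightarrow>
        integral {c..d} (\<lambda>x. \<phi> x * (\<eta>' x)\<^sup>2 - a\<^sup>2 * \<phi> x / x\<^sup>2 * (\<eta> x)\<^sup>2) \<ge> 0"
begin

text \<open>\<open>f\<close> stands for the derivative of \<open>h\<close>; it is a separate
  argument because test functions only have a right derivative.\<close>

definition energy :: "(real \<Rightarrow> real) \<Rightarrow> (real \<Rightarrow> real) \<Rightarrow> real \<Rightarrow> real" where
  "energy h f x = \<phi> x * (f x)\<^sup>2 - a\<^sup>2 * \<phi> x / x\<^sup>2 * (h x)\<^sup>2"

text \<open>\<open>lower s \<beta>\<close> bounds the value function of the variational problem on \<open>[s, \<infinity>)\<close> from below. That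
  function is minus the Riccati variable \<open>\<phi> h' / h\<close> of a positive solution \<open>h\<close> of the Euler equation;
  working with it avoids constructing \<open>h\<close>. Right derivatives make \<open>tests\<close> closed under gluing.\<close>

definition tests :: "real \<Rightarrow> real \<Rightarrow> real \<Rightarrow> bool" where
  "tests s y E \<longleftrightarrow> (\<exists>h f d L. s < d \<and> L-lipschitz_on {s..d} h \<and>
     (\<forall>x\<in>{s..<d}. (h has_real_derivative f x) (at_right x)) \<and>
     h s = y \<and> h d = 0 \<and> (energy h f has_integral E) {s..d})"

definition lower :: "real \<Rightarrow> real \<Rightarrow> bool" where
  "lower s \<beta> \<longleftrightarrow> (\<forall>E. tests s 1 E \<longrightarrow> \<beta> \<le> E)"

lemma testsI:
  assumes "s < d" "L-lipschitz_on {s..d} h"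
    "\<And>x. s \<le> x \<Longrightarrow> x < d \<Longrightarrow> (h has_real_derivative f x) (at_right x)"
    "h s = y" "h d = 0" "(energy h f has_integral E) {s..d}"
  shows "tests s y E"
  unfolding tests_def using assms by (intro exI[of _ h] exI[of _ f] exI[of _ d] exI[of _ L]) auto

lemma testsE:
  assumes "tests s y E"
  obtains h f d L where "s < d" "L-lipschitz_on {s..d} h"
    "\<And>x. s \<le> x \<Longrightarrow> x < d \<Longrightarrow> (h has_real_derivative f x) (at_right x)"
    "h s = y" "h d = 0" "(energy h f has_integral E) {s..d}"
  using assms unfolding tests_def by (elim exE conjE) (rule that, assumption+, auto)

lemma energy_integrable:
  assumes "R < s" "continuous_on {s..t} h" "continuous_on {s..t} f"
  shows "energy h f integrable_on {s..t}"
proof -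
  have "continuous_on {s..t} \<phi>"
    using assms(1) by (intro continuous_on_subset[OF cont]) auto
  then show ?thesis
    unfolding energy_def using assms R_nonneg
    by (intro integrable_continuous_real continuous_intros) auto
qed

lemma has_real_derivative_at_right:
  fixes h :: "real \<Rightarrow> real"
  assumes "(h has_real_derivative D) (at x within {s..t})" "s \<le> x" "x < t"
  shows "(h has_real_derivative D) (at_right x)"
proof -
  have "(h has_real_derivative D) (at x within {x<..<t})"
    using assms by (intro DERIV_subset[OF assms(1)]) auto
  moreover have "at x within {x<..<t} = at_right x"
    using assms by (intro at_within_nhd[of _ "{..<t}"]) auto
  ultimately show ?thesis
    by simp
qed

section \<open>Gluing and scaling of test functions\<close>

lemma tests_C1:
  assumes "R < s" "s < d"
    and der: "\<And>x. x \<in> {s..d} \<Longrightarrow> (h has_real_derivative f x) (at x within {s..d})"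
    and f: "continuous_on {s..d} f" and "h d = 0"
  shows "tests s (h s) (integral {s..d} (energy h f))"
proof -
  obtain L where L: "L-lipschitz_on {s..d} h"
    using lipschitz_on_has_real_derivative[OF der f] by blast
  have "continuous_on {s..d} h"
    using der by (rule DERIV_continuous_on)
  then have int: "(energy h f has_integral integral {s..d} (energy h f)) {s..d}"
    using energy_integrable[OF assms(1) _ f] by (simp add: integrable_integral)
  show ?thesis
    by (rule testsI[OF \<open>s < d\<close> L _ refl \<open>h d = 0\<close> int])
      (auto intro!: has_real_derivative_at_right[where s = s and t = d] der)
qed

text \<open>A kink at \<open>t\<close> is harmless because only right derivatives are recorded. This
  is the dynamic programming step that relates the value functions at \<open>s\<close> and at
  \<open>t\<close>.\<close>

lemma tests_glue:
  assumes "R < s" "s < t"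
    and der: "\<And>x. x \<in> {s..t} \<Longrightarrow> (h has_real_derivative f x) (at x within {s..t})"
    and f: "continuous_on {s..t} f"
    and "tests t (h t) E"
  shows "tests s (h s) (integral {s..t} (energy h f) + E)"
proof -
  obtain L where L: "L-lipschitz_on {s..t} h"
    using lipschitz_on_has_real_derivative[OF der f] by blast
  have "continuous_on {s..t} h"
    using der by (rule DERIV_continuous_on)
  then have int: "(energy h f has_integral integral {s..t} (energy h f)) {s..t}"
    using energy_integrable[OF assms(1) _ f] by (simp add: integrable_integral)
  obtain k g d M where k: "t < d" "M-lipschitz_on {t..d} k"
     "\<And>x. t \<le> x \<Longrightarrow> x < d \<Longrightarrow> (k has_real_derivative g x) (at_right x)"
     "k t = h t" "k d = 0" "(energy k g has_integral E) {t..d}"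
    using assms(5) by (rule testsE) (rule that)
  define H where "H x = (if x \<le> t then h x else k x)" for x
  \<comment> \<open>The strict inequality gives \<open>F\<close> the slope of \<open>k\<close> at
    \<open>t\<close>, which is the right derivative of \<open>H\<close> there, although
    \<open>H t\<close> is read from \<open>h\<close>.\<close>
  define F where "F x = (if x < t then f x else g x)" for x
  show ?thesis
  proof (rule testsI[of s d "max L M" H F])
    show "s < d" "H s = h s" "H d = 0"
      using assms k by (auto simp: H_def)
    show "(max L M)-lipschitz_on {s..d} H"
      unfolding H_def using L k(2) k(4) by (intro lipschitz_on_concat_max) auto
    show "(H has_real_derivative F x) (at_right x)" if "s \<le> x" "x < d" for x
    proof (cases "x < t")
      case True
      have "(h has_real_derivative f x) (at_right x)"
        using der[of x] that True by (intro has_real_derivative_at_right[of h _ _ s t]) auto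
      then have "(H has_real_derivative f x) (at_right x)"
        by (rule has_real_derivative_right_cong[of _ _ _ t]) (use True in \<open>auto simp: H_def\<close>)
      then show ?thesis
        using True by (simp add: F_def)
    next
      case False
      then have "(H has_real_derivative g x) (at_right x)"
        using k(4) that by (intro has_real_derivative_right_cong[OF k(3), of x d])
          (auto simp: H_def dest: order_antisym)
      then show ?thesis
        using False by (simp add: F_def)
    qed
    have "(energy H F has_integral integral {s..t} (energy h f)) {s..t}"
      by (rule has_integral_spike_finite[OF _ _ int, of "{t}"]) (auto simp: energy_def H_def F_def)
    moreover have "(energy H F has_integral E) {t..d}"
      by (rule has_integral_spike_finite[OF _ _ k(6), of "{}"]) (use k(4) in \<open>auto simp: energy_def H_def F_def\<close>)
    ultimately show "(energy H F has_integral integral {s..t} (energy h f) + E) {s..d}"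
      using assms k by (intro has_integral_combine[of s t d]) auto
  qed
qed

text \<open>The energy is quadratic. Scaling fits a tail with initial value 1 to the end value of
  any arc before it.\<close>

lemma tests_scale:
  assumes "tests t y E"
  shows "tests t (c * y) (c\<^sup>2 * E)"
proof -
  obtain k g d M where k: "t < d" "M-lipschitz_on {t..d} k"
     "\<And>x. t \<le> x \<Longrightarrow> x < d \<Longrightarrow> (k has_real_derivative g x) (at_right x)"
     "k t = y" "k d = 0" "(energy k g has_integral E) {t..d}"
    using assms by (rule testsE) (rule that)
  have "energy (\<lambda>x. c * k x) (\<lambda>x. c * g x) = (\<lambda>x. c\<^sup>2 * energy k g x)"
    by (auto simp: energy_def power_mult_distrib algebra_simps)
  then have "(energy (\<lambda>x. c * k x) (\<lambda>x. c * g x) has_integral c\<^sup>2 * E) {t..d}"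
    using has_integral_mult_right[OF k(6), of "c\<^sup>2"] by simp
  then show ?thesis
    using k by (intro testsI[of t d "\<bar>c\<bar> * M" "\<lambda>x. c * k x" "\<lambda>x. c * g x"] lipschitz_on_cmult_real DERIV_cmult) auto
qed

text \<open>Vanishing at \<open>s\<close> permits an extension by zero to a Lipschitz function on
  the line, to which the Hardy inequality applies in its Lipschitz form.\<close>

lemma tests_nonneg:
  assumes "R < s" "tests s 0 E"
  shows "0 \<le> E"
proof -
  obtain h f d L where h: "s < d" "L-lipschitz_on {s..d} h"
     "\<And>x. s \<le> x \<Longrightarrow> x < d \<Longrightarrow> (h has_real_derivative f x) (at_right x)"
     "h s = 0" "h d = 0" "(energy h f has_integral E) {s..d}"
    using assms(2) by (rule testsE) (rule that)
  \<comment> \<open>Clamping the argument to \<open>[s, d]\<close> extends \<open>h\<close> by its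
    end values, both zero, and keeps the Lipschitz constant.\<close>
  define H where "H x = h (max s (min x d))" for x
  define F where "F x = (if s \<le> x \<and> x < d then f x else 0)" for x
  have L: "L \<ge> 0"
    using h(2) by (rule lipschitz_on_nonneg)
  have lip: "L-lipschitz_on UNIV H"
  proof (rule lipschitz_onI)
    fix x y
    have "dist (H x) (H y) \<le> L * dist (max s (min x d)) (max s (min y d))"
      unfolding H_def using h(1) by (intro lipschitz_onD[OF h(2)]) auto
    also have "\<dots> \<le> L * dist x y"
      using L by (intro mult_left_mono) (auto simp: dist_real_def max_def min_def abs_if)
    finally show "dist (H x) (H y) \<le> L * dist x y" .
  qed (fact L)
  have zero: "H x = 0" if "x \<notin> {s<..<d}" for x
    using that h by (auto simp: H_def max_def min_def)
  have der: "(H has_real_derivative F x) (at_right x)" for x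
  proof -
    consider "x < s" | "s \<le> x" "x < d" | "d \<le> x"
      by linarith
    then show ?thesis
    proof cases
      case 1
      have "(H has_real_derivative 0) (at_right x)"
        by (rule has_real_derivative_right_cong[OF DERIV_const[of 0], of _ s])
          (use 1 zero h(1) in auto)
      then show ?thesis
        using 1 by (simp add: F_def)
    next
      case 2
      have "(H has_real_derivative f x) (at_right x)"
        by (rule has_real_derivative_right_cong[OF h(3), of x d])
          (use 2 in \<open>auto simp: H_def max_def min_def\<close>)
      then show ?thesis
        using 2 by (simp add: F_def)
    next
      case 3
      have "(H has_real_derivative 0) (at_right x)"
        by (rule has_real_derivative_right_cong[OF DERIV_const[of 0], of _ "x + 1"])
          (use 3 zero in auto)
      then show ?thesis
        using 3 by (simp add: F_def)
    qed
  qed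
  have "continuous_on {R<..} (\<lambda>x. a\<^sup>2 * \<phi> x / x\<^sup>2)"
    using R_nonneg by (intro continuous_intros cont) auto
  from energy_nonneg_lipschitz[OF cont this C1_ineq assms(1) h(1) lip zero der]
  have "integral {s..d} (energy H F) \<ge> 0"
    unfolding energy_def by simp
  moreover have "(energy H F has_integral E) {s..d}"
    by (rule has_integral_spike_finite[OF _ _ h(6), of "{d}"]) (auto simp: energy_def H_def F_def)
  ultimately show ?thesis
    by (simp add: integral_unique)
qed

section \<open>Bounds on the value function and their propagation\<close>

lemma lower_bounded:
  assumes "R < s"
  shows "\<exists>C>0. lower s (- C)"
proof -
  define c where "c = (R + s) / 2"
  have c: "R < c" "c < s"
    using assms by (auto simp: c_def)
  \<comment> \<open>A linear ramp from 0 at \<open>c\<close> to 1 at \<open>s\<close>. Put before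
    any test function it gives one vanishing at \<open>c\<close>, whose total energy
    \<open>I + E\<close> is nonnegative.\<close>
  define h where "h x = (x - c) / (s - c)" for x
  define I where "I = integral {c..s} (energy h (\<lambda>_. 1 / (s - c)))"
  have "- (\<bar>I\<bar> + 1) \<le> E" if E: "tests s 1 E" for E
  proof -
    have "tests c (h c) (I + E)"
      unfolding I_def using c E
      by (intro tests_glue) (auto simp: h_def[abs_def] intro!: derivative_eq_intros)
    then have "0 \<le> I + E"
      using c by (intro tests_nonneg[of c]) (auto simp: h_def)
    then show ?thesis
      by linarith
  qed
  then have "lower s (- (\<bar>I\<bar> + 1))"
    by (simp add: lower_def)
  then show ?thesis
    by (intro exI[of _ "\<bar>I\<bar> + 1"]) auto
qed

text \<open>The arc \<open>h x = (x / s) powr \<kappa>\<close> put before a test function has energy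
  density \<open>(\<kappa>\<^sup>2 - a\<^sup>2) * \<phi> * h\<^sup>2 / x\<^sup>2\<close>. It
  vanishes for \<open>\<kappa> = a\<close> and \<open>\<kappa> = - a\<close>, and is at most zero in
  between.\<close>

lemma lower_powr:
  assumes low: "lower s \<beta>" and st: "R < s" "s < t" and E: "tests t 1 E"
  shows "\<beta> \<le> (\<kappa>\<^sup>2 - a\<^sup>2) * s powr (- 2 * \<kappa>) * integral {s..t} (\<lambda>x. \<phi> x * x powr (2 * \<kappa> - 2))
            + (t / s) powr (2 * \<kappa>) * E"
proof -
  define h where "h x = (x / s) powr \<kappa>" for x
  define f where "f x = \<kappa> * (x / s) powr \<kappa> / x" for x
  have s: "s > 0"
    using st R_nonneg by simp
  have sq: "((x / s) powr \<kappa>)\<^sup>2 = s powr (- 2 * \<kappa>) * x powr (2 * \<kappa>)" if "x > 0" for x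
    using that s by (simp add: power2_eq_square powr_add[symmetric] powr_divide powr_minus divide_simps)
  have "tests s (h s) (integral {s..t} (energy h f) + (h t)\<^sup>2 * E)"
  proof (rule tests_glue[OF st])
    show "(h has_real_derivative f x) (at x within {s..t})" if "x \<in> {s..t}" for x
      unfolding h_def f_def using that s
      by (auto intro!: derivative_eq_intros simp: powr_diff)
    show "continuous_on {s..t} f"
      unfolding f_def using s by (intro continuous_intros) auto
    show "tests t (h t) ((h t)\<^sup>2 * E)"
      using tests_scale[OF E, of "h t"] by simp
  qed
  moreover have "h s = 1"
    using s by (simp add: h_def)
  ultimately have "\<beta> \<le> integral {s..t} (energy h f) + (h t)\<^sup>2 * E"
    using low by (auto simp: lower_def)
  also have "integral {s..t} (energy h f) =
      integral {s..t} (\<lambda>x. ((\<kappa>\<^sup>2 - a\<^sup>2) * s powr (- 2 * \<kappa>)) * (\<phi> x * x powr (2 * \<kappa> - 2)))"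
  proof (rule integral_cong)
    fix x assume "x \<in> {s..t}"
    then have x: "x > 0"
      using s by auto
    have "energy h f x = \<phi> x * (\<kappa>\<^sup>2 - a\<^sup>2) * ((x / s) powr \<kappa>)\<^sup>2 / x\<^sup>2"
      using x by (simp add: energy_def h_def f_def power_divide power_mult_distrib field_simps)
    also have "\<dots> = ((\<kappa>\<^sup>2 - a\<^sup>2) * s powr (- 2 * \<kappa>)) * (\<phi> x * x powr (2 * \<kappa> - 2))"
      using x by (simp add: sq powr_diff)
    finally show "energy h f x = \<dots>" .
  qed
  also have "\<dots> = (\<kappa>\<^sup>2 - a\<^sup>2) * s powr (- 2 * \<kappa>) * integral {s..t} (\<lambda>x. \<phi> x * x powr (2 * \<kappa> - 2))"
    by (rule integral_mult_right)
  also have "(h t)\<^sup>2 = (t / s) powr (2 * \<kappa>)"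
    using st s by (simp add: h_def power2_eq_square powr_add[symmetric])
  finally show ?thesis .
qed

text \<open>The decreasing power, \<open>\<kappa> = - a\<close>, costs no energy and serves for
  \<open>\<beta> > 0\<close>. The increasing power, \<open>\<kappa> = a\<close>, in
  \<open>lower_shrink\<close> serves for negative bounds.\<close>

lemma lower_grow:
  assumes "lower s \<beta>" "R < s" "s \<le> t"
  shows "lower t ((t / s) powr (2 * a) * \<beta>)"
proof (cases "s = t")
  case False
  have "(t / s) powr (2 * a) * \<beta> \<le> E" if "tests t 1 E" for E
  proof -
    have "\<beta> \<le> (t / s) powr (- (2 * a)) * E"
      using lower_powr[OF assms(1,2) _ that, of "- a"] False assms by simp
    then show ?thesis
      using assms R_nonneg by (simp add: powr_minus divide_simps mult.commute)
  qed
  then show ?thesis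
    by (simp add: lower_def)
qed (use assms R_nonneg in auto)

lemma lower_shrink:
  assumes "lower s \<beta>" "R < s" "s \<le> t"
  shows "lower t ((t / s) powr (- (2 * a)) * \<beta>)"
proof (cases "s = t")
  case False
  have "(t / s) powr (- (2 * a)) * \<beta> \<le> E" if "tests t 1 E" for E
  proof -
    have "\<beta> \<le> (t / s) powr (2 * a) * E"
      using lower_powr[OF assms(1,2) _ that, of a] False assms by simp
    then show ?thesis
      using assms R_nonneg by (simp add: powr_minus divide_simps mult.commute)
  qed
  then show ?thesis
    by (simp add: lower_def)
qed (use assms R_nonneg in auto)

text \<open>The test function runs from 1 to 0 with slope proportional to \<open>1 / p\<close>. It
  minimises the integral of \<open>p * h'\<^sup>2\<close>, and the minimum is the reciprocal of the
  integral of \<open>1 / p\<close>. Dropping the Hardy term and replacing \<open>\<phi>\<close> by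
  \<open>p\<close> only increases the energy.\<close>

lemma integral_inverse_le:
  assumes low: "lower s \<beta>" "\<beta> > 0" and st: "R < s" "s < t"
    and p: "continuous_on {s..t} p" "\<And>x. x \<in> {s..t} \<Longrightarrow> 0 < p x" "\<And>x. x \<in> {s..t} \<Longrightarrow> \<phi> x \<le> p x"
  shows "integral {s..t} (\<lambda>x. 1 / p x) \<le> 1 / \<beta>"
proof -
  have cont_p: "continuous_on {s..t} (\<lambda>x. 1 / p x)"
    using p(1) p(2) by (intro continuous_intros) (metis less_irrefl)+
  define I where "I = integral {s..t} (\<lambda>x. 1 / p x)"
  define J where "J x = integral {s..x} (\<lambda>x. 1 / p x)" for x
  have "I > 0"
  proof -
    have "0 \<le> I"
      unfolding I_def using p by (intro integral_nonneg integrable_continuous_real cont_p) (auto simp: less_imp_le)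
    moreover have "I \<noteq> 0"
      unfolding I_def using integral_eq_0_iff[OF cont_p st(2)] p st by (fastforce simp: less_imp_le)
    ultimately show ?thesis
      by simp
  qed
  define h where "h x = 1 - J x / I" for x
  define f where "f x = - (1 / p x) / I" for x
  have der: "(h has_real_derivative f x) (at x within {s..t})" if "x \<in> {s..t}" for x
  proof -
    have "(J has_real_derivative 1 / p x) (at x within {s..t})"
      unfolding J_def using integral_has_real_derivative[OF cont_p that] .
    then show ?thesis
      unfolding h_def f_def using \<open>I > 0\<close> by (auto intro!: derivative_eq_intros)
  qed
  have cont_f: "continuous_on {s..t} f"
    unfolding f_def using \<open>I > 0\<close> by (intro continuous_on_divide continuous_on_minus cont_p continuous_intros) auto
  have cont_h: "continuous_on {s..t} h"
    using der by (rule DERIV_continuous_on)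
  have "tests s (h s) (integral {s..t} (energy h f))"
  proof (intro tests_C1 st der cont_f)
    show "h t = 0"
      using \<open>I > 0\<close> by (simp add: h_def J_def I_def)
  qed
  moreover have "h s = 1"
    by (simp add: h_def J_def)
  ultimately have "\<beta> \<le> integral {s..t} (energy h f)"
    using low by (auto simp: lower_def)
  also have "\<dots> \<le> integral {s..t} (\<lambda>x. 1 / I\<^sup>2 * (1 / p x))"
  proof (rule integral_le)
    show "energy h f integrable_on {s..t}"
      using st cont_h cont_f by (intro energy_integrable) auto
    show "(\<lambda>x. 1 / I\<^sup>2 * (1 / p x)) integrable_on {s..t}"
      by (intro integrable_continuous_real continuous_on_mult_left cont_p)
    fix x assume x: "x \<in> {s..t}"
    then have "\<phi> x \<ge> 0" "p x > 0" "\<phi> x \<le> p x"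
      using nonneg[of x] st p by auto
    then have "energy h f x \<le> \<phi> x * (f x)\<^sup>2"
      by (simp add: energy_def)
    also have "\<dots> \<le> p x * (f x)\<^sup>2"
      using \<open>\<phi> x \<le> p x\<close> by (rule mult_right_mono) auto
    also have "\<dots> = 1 / I\<^sup>2 * (1 / p x)"
      using \<open>p x > 0\<close> by (simp add: f_def power_divide power2_eq_square)
    finally show "energy h f x \<le> 1 / I\<^sup>2 * (1 / p x)" .
  qed
  also have "\<dots> = 1 / I\<^sup>2 * I"
    unfolding I_def by (rule integral_mult_right)
  finally have "\<beta> \<le> 1 / I"
    using \<open>I > 0\<close> by (simp add: power2_eq_square)
  then show ?thesis
    using \<open>I > 0\<close> low by (simp add: I_def[symmetric] field_simps)
qed

text \<open>Without a positive lower bound at \<open>t\<close> there are test functions from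
  \<open>t\<close> on with energy below any positive number. The tail in \<open>lower_powr\<close>
  is then negligible and only the weighted integral remains.\<close>

lemma integral_weight_le:
  assumes low: "lower s (- \<gamma>)" and st: "R < s" "s < t" and not: "\<And>\<beta>. \<beta> > 0 \<Longrightarrow> \<not> lower t \<beta>"
  shows "(a\<^sup>2 - \<kappa>\<^sup>2) * integral {s..t} (\<lambda>x. \<phi> x * x powr (2 * \<kappa> - 2)) \<le> \<gamma> * s powr (2 * \<kappa>)"
proof -
  have s: "s > 0"
    using st R_nonneg by simp
  define A where "A = (t / s) powr (2 * \<kappa>)"
  have A: "A > 0"
    using s st by (simp add: A_def)
  let ?I = "integral {s..t} (\<lambda>x. \<phi> x * x powr (2 * \<kappa> - 2))"
  have "(a\<^sup>2 - \<kappa>\<^sup>2) * s powr (- 2 * \<kappa>) * ?I \<le> \<gamma>"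
  proof (rule field_le_epsilon)
    fix e :: real assume "e > 0"
    then obtain E where E: "tests t 1 E" "E < e / A"
      using not[of "e / A"] A by (auto simp: lower_def not_le)
    have "- \<gamma> \<le> (\<kappa>\<^sup>2 - a\<^sup>2) * s powr (- 2 * \<kappa>) * ?I + A * E"
      unfolding A_def by (rule lower_powr[OF low st E(1)])
    moreover have "A * E < e"
      using E(2) A by (simp add: field_simps)
    ultimately show "(a\<^sup>2 - \<kappa>\<^sup>2) * s powr (- 2 * \<kappa>) * ?I \<le> \<gamma> + e"
      by (simp add: algebra_simps)
  qed
  then show ?thesis
    using s by (simp add: powr_minus field_simps)
qed

text \<open>The split asks whether some \<open>\<beta> > 0\<close> is a lower bound at some
  \<open>s0 \<ge> s1\<close>. If so, \<open>lower_grow\<close> propagates it. If not,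
  \<open>integral_weight_le\<close> applies at every \<open>t\<close> beyond \<open>s1\<close>, with
  the finite bound at \<open>s1\<close> carried to \<open>s\<close> by \<open>lower_shrink\<close>.
  The exponent \<open>\<kappa>\<close> stays free because dimension 2 and higher dimensions call for
  different choices.\<close>

lemma dichotomy:
  assumes s1: "R < s1"
  obtains (grow) s0 \<beta> where "s1 \<le> s0" "\<beta> > 0"
      "\<And>s t p. s0 \<le> s \<Longrightarrow> s < t \<Longrightarrow> continuous_on {s..t} p \<Longrightarrow>
         (\<And>x. x \<in> {s..t} \<Longrightarrow> 0 < p x) \<Longrightarrow> (\<And>x. x \<in> {s..t} \<Longrightarrow> \<phi> x \<le> p x) \<Longrightarrow>
         integral {s..t} (\<lambda>x. 1 / p x) \<le> 1 / (\<beta> * s powr (2 * a))"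
    | (decay) C where "C > 0"
      "\<And>s t \<kappa>. s1 \<le> s \<Longrightarrow> s < t \<Longrightarrow>
         (a\<^sup>2 - \<kappa>\<^sup>2) * integral {s..t} (\<lambda>x. \<phi> x * x powr (2 * \<kappa> - 2)) \<le> C * s powr (2 * \<kappa> - 2 * a)"
proof (cases "\<exists>s0\<ge>s1. \<exists>\<beta>>0. lower s0 \<beta>")
  case True
  then obtain s0 \<beta> where b: "s1 \<le> s0" "\<beta> > 0" "lower s0 \<beta>"
    by auto
  have s0: "R < s0" "0 < s0"
    using s1 b R_nonneg by auto
  show thesis
  proof (rule grow[of s0 "\<beta> / s0 powr (2 * a)"])
    fix s t :: real and p :: "real \<Rightarrow> real" assume st: "s0 \<le> s" "s < t" and p: "continuous_on {s..t} p"
         "\<And>x. x \<in> {s..t} \<Longrightarrow> 0 < p x" "\<And>x. x \<in> {s..t} \<Longrightarrow> \<phi> x \<le> p x"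
    have "integral {s..t} (\<lambda>x. 1 / p x) \<le> 1 / ((s / s0) powr (2 * a) * \<beta>)"
      using st s0 b p by (intro integral_inverse_le lower_grow) auto
    then show "integral {s..t} (\<lambda>x. 1 / p x) \<le> 1 / (\<beta> / s0 powr (2 * a) * s powr (2 * a))"
      using st s0 by (simp add: powr_divide mult.commute)
  qed (use b s0 in auto)
next
  case False
  obtain C where C: "C > 0" "lower s1 (- C)"
    using lower_bounded[OF s1] by auto
  have pos: "s1 > 0"
    using s1 R_nonneg by simp
  show thesis
  proof (rule decay[of "C * s1 powr (2 * a)"])
    fix s t \<kappa> assume st: "s1 \<le> s" "s < t"
    have "lower s (- ((s / s1) powr (- (2 * a)) * C))"
      using lower_shrink[OF C(2) s1 st(1)] by simp
    then have "(a\<^sup>2 - \<kappa>\<^sup>2) * integral {s..t} (\<lambda>x. \<phi> x * x powr (2 * \<kappa> - 2))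
        \<le> (s / s1) powr (- (2 * a)) * C * s powr (2 * \<kappa>)"
      using st s1 False by (intro integral_weight_le) auto
    also have "\<dots> = C * s1 powr (2 * a) * s powr (2 * \<kappa> - 2 * a)"
      using pos st by (simp add: powr_divide powr_minus powr_diff field_simps)
    finally show "(a\<^sup>2 - \<kappa>\<^sup>2) * integral {s..t} (\<lambda>x. \<phi> x * x powr (2 * \<kappa> - 2)) \<le> \<dots>" .
  qed (use C pos in auto)
qed

end

subsection \<open>Conditions (L) and (S) from increments\<close>

text \<open>Condition (L) is derived from increments for increasing \<open>w\<close> only; this
  reduces decreasing profiles to that case. The sign change also covers infinite limits.\<close>

lemma condition_L_uminus:
  assumes "condition_L N w"
  shows "condition_L N (\<lambda>r. - w r)"
proof -
  obtain M r0 where M: "M > 0" "r0 \<ge> 1"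
    "2 \<le> N \<and> N \<le> 9 \<longrightarrow> (\<forall>r\<ge>r0. \<bar>w r\<bar> \<ge> M * r powr (- real N / 2 + sqrt (real N - 1) + 2))"
    "N = 10 \<longrightarrow> (\<forall>r\<ge>r0. \<bar>w r\<bar> \<ge> M * ln r)"
    "N \<ge> 11 \<longrightarrow> (\<exists>l. has_limit_at_infinity w l \<and>
       (\<forall>r\<ge>r0. \<bar>ereal (w r) - l\<bar> \<ge> ereal (M * r powr (- real N / 2 + sqrt (real N - 1) + 2))))"
    using assms unfolding condition_L_def by (elim exE conjE) (rule that)
  have "\<exists>l. has_limit_at_infinity (\<lambda>r. - w r) l \<and>
       (\<forall>r\<ge>r0. \<bar>ereal (- w r) - l\<bar> \<ge> ereal (M * r powr (- real N / 2 + sqrt (real N - 1) + 2)))" if "N \<ge> 11"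
  proof -
    from M(5) that obtain l where l: "has_limit_at_infinity w l"
      "\<And>r. r \<ge> r0 \<Longrightarrow> \<bar>ereal (w r) - l\<bar> \<ge> ereal (M * r powr (- real N / 2 + sqrt (real N - 1) + 2))"
      by blast
    have "\<bar>ereal (- w r) - (- l)\<bar> = \<bar>ereal (w r) - l\<bar>" for r
      by (cases l) auto
    moreover have "has_limit_at_infinity (\<lambda>r. - w r) (- l)"
      using tendsto_uminus_ereal[OF l(1)[unfolded has_limit_at_infinity_def]]
      by (simp add: has_limit_at_infinity_def)
    ultimately show ?thesis
      using l(2) by (intro exI[of _ "- l"]) simp
  qed
  with M(1-4) show ?thesis
    unfolding condition_L_def abs_minus_cancel by (intro exI[of _ M] conjI exI[of _ r0]) simp_all
qed

lemma has_limit_at_infinity_cong: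
  assumes "\<And>r. r \<ge> 1 \<Longrightarrow> v r = w r"
  shows "has_limit_at_infinity v l \<longleftrightarrow> has_limit_at_infinity w l"
  unfolding has_limit_at_infinity_def
  by (intro tendsto_cong eventually_mono[OF eventually_ge_at_top[of 1]]) (simp add: assms)

text \<open>Both conditions look only at \<open>r \<ge> 1\<close>, so the profile chosen with
  \<open>SOME\<close> may be replaced by the values of the solution along an axis.\<close>

lemma condition_L_cong:
  assumes "\<And>r. r \<ge> 1 \<Longrightarrow> v r = w r"
  shows "condition_L N v \<longleftrightarrow> condition_L N w"
  unfolding condition_L_def
  by (intro ex_cong1 conj_cong refl imp_cong all_cong)
    (auto simp: assms has_limit_at_infinity_cong[of v w, OF assms])

lemma condition_S_cong:
  assumes "\<And>r. r \<ge> 1 \<Longrightarrow> v r = w r"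
  shows "condition_S N v \<longleftrightarrow> condition_S N w"
  unfolding condition_S_def
  by (intro ex_cong1 conj_cong refl imp_cong all_cong)
    (auto simp: assms has_limit_at_infinity_cong[of v w, OF assms])

text \<open>For \<open>N \<ge> 4\<close> squaring turns the claim into
  \<open>(N - 2) * (10 - N) > 0\<close>, which is where the critical dimension 10 comes from. At
  \<open>N = 2\<close> this product vanishes, so small \<open>N\<close> is treated directly.\<close>

lemma growth_exponent_pos:
  assumes "2 \<le> N" "N \<le> 9"
  shows "- real N / 2 + sqrt (real N - 1) + 2 > 0"
proof (cases "N \<le> 3")
  case True
  have "sqrt (real N - 1) \<ge> 0"
    using assms by simp
  then show ?thesis
    using True by linarith
next
  case False
  have "0 < (real N - 2) * (10 - real N)"
    using False assms by (intro mult_pos_pos) auto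
  then have "(real N / 2 - 2)\<^sup>2 < real N - 1"
    by (simp add: power2_eq_square algebra_simps)
  then have "real N / 2 - 2 < sqrt (real N - 1)"
    by (rule real_less_rsqrt)
  then show ?thesis
    by simp
qed

lemma increasing_ereal_limit:
  fixes w :: "real \<Rightarrow> real"
  assumes "\<And>x y. s \<le> x \<Longrightarrow> x \<le> y \<Longrightarrow> w x \<le> w y"
  obtains l where "has_limit_at_infinity w l" "\<And>x. s \<le> x \<Longrightarrow> ereal (w x) \<le> l"
proof -
  define l where "l = (SUP x\<in>{s..}. ereal (w x))"
  have le: "ereal (w x) \<le> l" if "s \<le> x" for x
    unfolding l_def using that by (intro SUP_upper) auto
  have "((\<lambda>r. ereal (w r)) \<longlongrightarrow> l) at_top"
  proof (rule order_tendstoI)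
    fix y assume "y < l"
    then obtain x where x: "s \<le> x" "y < ereal (w x)"
      by (auto simp: l_def less_SUP_iff)
    have "y < ereal (w r)" if "r \<ge> x" for r
      using x assms[of x r] that by (meson ereal_less_eq(3) order_less_le_trans)
    then show "\<forall>\<^sub>F r in at_top. y < ereal (w r)"
      unfolding eventually_at_top_linorder by blast
  next
    fix y assume "l < y"
    then show "\<forall>\<^sub>F r in at_top. ereal (w r) < y"
      unfolding eventually_at_top_linorder using le by (meson order_le_less_trans)
  qed
  then show thesis
    using le that by (auto simp: has_limit_at_infinity_def)
qed

text \<open>The sign of the exponent decides how the increments are used. If it is positive, the
  last increment, over \<open>[r / 2, r]\<close>, dominates the initial value. If it is zero,
  \<open>N = 10\<close>, about \<open>log 2 (r / s)\<close> increments of size at least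
  \<open>c\<close> add up to a logarithm. For \<open>N \<ge> 11\<close> one increment bounds the
  distance to the limit, which is at least \<open>w (2 * r)\<close>.\<close>

lemma condition_L_if_doubling:
  fixes w :: "real \<Rightarrow> real"
  assumes s: "s \<ge> 1" and c: "c > 0"
    and mono: "\<And>x y. s \<le> x \<Longrightarrow> x \<le> y \<Longrightarrow> w x \<le> w y"
    and doubling: "\<And>r. s \<le> r \<Longrightarrow> c * r powr (- real N / 2 + sqrt (real N - 1) + 2) \<le> w (2 * r) - w r"
  shows "condition_L N w"
proof -
  define \<gamma> where "\<gamma> = - real N / 2 + sqrt (real N - 1) + 2"
  have doubling': "c * r powr \<gamma> \<le> w (2 * r) - w r" if "s \<le> r" for r
    using doubling[OF that] by (simp add: \<gamma>_def)
  consider "2 \<le> N \<and> N \<le> 9" | "N = 10" | "N \<ge> 11" | "N < 2"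
    by linarith
  then show ?thesis
  proof cases
    case 1
    then have \<gamma>: "\<gamma> > 0"
      using growth_exponent_pos[of N] by (simp add: \<gamma>_def)
    \<comment> \<open>This makes \<open>c * (r / 2) powr \<gamma>\<close> larger than
      \<open>2 * \<bar>w s\<bar>\<close>, so half of the increment survives after absorbing
      \<open>w s\<close>.\<close>
    define K where "K = (2 * \<bar>w s\<bar> + 1) / c"
    have K: "K > 0"
      using c by (simp add: K_def)
    define r0 where "r0 = 2 * max s (K powr (1 / \<gamma>))"
    have "c / 2 * (1 / 2) powr \<gamma> * r powr \<gamma> \<le> \<bar>w r\<bar>" if r: "r \<ge> r0" for r
    proof -
      have r2: "s \<le> r / 2" "K powr (1 / \<gamma>) \<le> r / 2"
        using r by (auto simp: r0_def)
      have "K = (K powr (1 / \<gamma>)) powr \<gamma>"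
        using \<gamma> K by (simp add: powr_powr)
      also have "\<dots> \<le> (r / 2) powr \<gamma>"
        using r2 \<gamma> by (intro powr_mono2) auto
      finally have "c * K \<le> c * (r / 2) powr \<gamma>"
        using c by simp
      then have "2 * \<bar>w s\<bar> + 1 \<le> c * (r / 2) powr \<gamma>"
        using c by (simp add: K_def)
      moreover have "c * (r / 2) powr \<gamma> \<le> w r - w (r / 2)"
        using doubling'[OF r2(1)] by simp
      moreover have "w s \<le> w (r / 2)"
        using r2 by (intro mono) auto
      ultimately have "c / 2 * (r / 2) powr \<gamma> \<le> \<bar>w r\<bar>"
        by linarith
      moreover have "(r / 2) powr \<gamma> = (1 / 2) powr \<gamma> * r powr \<gamma>"
        using r2 s by (simp add: powr_mult[symmetric])
      ultimately show ?thesis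
        by (simp add: mult.assoc)
    qed
    then show ?thesis
      unfolding condition_L_def \<gamma>_def using 1 s c
      by (intro exI[of _ "c / 2 * (1 / 2) powr \<gamma>"] exI[of _ r0] conjI) (auto simp: r0_def \<gamma>_def)
  next
    case 2
    then have "\<gamma> = 0"
      by (simp add: \<gamma>_def)
    have step: "w s + real n * c \<le> w (2 ^ n * s)" for n
    proof (induction n)
      case (Suc n)
      have "1 * s \<le> 2 ^ n * s"
        using s by (intro mult_right_mono) auto
      then have "c \<le> w (2 * (2 ^ n * s)) - w (2 ^ n * s)"
        using doubling'[of "2 ^ n * s"] \<open>\<gamma> = 0\<close> s by simp
      then show ?case
        using Suc by (simp add: algebra_simps)
    qed simp
    have log_le: "w s + c * (log 2 (r / s) - 1) \<le> w r" if r: "s \<le> r" for r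
    proof -
      define n where "n = nat \<lfloor>log 2 (r / s)\<rfloor>"
      have "log 2 (r / s) \<ge> 0"
        using r s by (simp add: zero_le_log_cancel_iff)
      then have n: "real n \<le> log 2 (r / s)" "log 2 (r / s) - 1 \<le> real n"
        unfolding n_def by linarith+
      have "2 powr real n \<le> r / s"
        using n(1) r s by (subst (asm) le_log_iff) auto
      then have "2 ^ n * s \<le> r"
        using s by (simp add: powr_realpow field_simps)
      moreover have "1 * s \<le> 2 ^ n * s"
        using s by (intro mult_right_mono) auto
      ultimately have "w (2 ^ n * s) \<le> w r"
        by (intro mono) auto
      moreover have "c * (log 2 (r / s) - 1) \<le> real n * c"
        using n(2) c by (simp add: mult.commute)
      ultimately show ?thesis
        using step[of n] by linarith
    qed
    \<comment> \<open>\<open>K\<close> collects what does not depend on \<open>r\<close>; beyond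
      \<open>exp (2 * K / c)\<close> half of \<open>c * ln r\<close> absorbs it.\<close>
    define K where "K = \<bar>w s\<bar> + c * (1 + log 2 s)"
    define r0 where "r0 = max s (exp (2 * K / c))"
    have "c / 2 * ln r \<le> \<bar>w r\<bar>" if r: "r \<ge> r0" for r
    proof -
      have "r > 0" "r \<ge> s" "exp (2 * K / c) \<le> r"
        using r s by (auto simp: r0_def)
      then have "2 * K / c \<le> ln r"
        by (simp add: ln_ge_iff)
      then have "2 * K \<le> c * ln r"
        using c by (simp add: field_simps)
      moreover have "c * ln r \<le> c * log 2 r"
      proof -
        have "ln r \<ge> 0" "0 < ln (2::real)" "ln (2::real) \<le> 1"
          using \<open>r \<ge> s\<close> s ln_2_less_1 by auto
        then have "ln r * ln 2 \<le> ln r * 1"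
          by (intro mult_left_mono) auto
        then have "ln r \<le> log 2 r"
          by (simp add: log_def field_simps)
        then show ?thesis
          using c by simp
      qed
      moreover have "w s + c * (log 2 r - log 2 s - 1) \<le> w r"
        using log_le[OF \<open>r \<ge> s\<close>] \<open>r > 0\<close> s by (simp add: log_divide)
      ultimately show ?thesis
        by (simp add: K_def algebra_simps)
    qed
    then show ?thesis
      unfolding condition_L_def using 2 s c
      by (intro exI[of _ "c / 2"] exI[of _ r0] conjI) (auto simp: r0_def)
  next
    case 3
    obtain l where l: "has_limit_at_infinity w l" "\<And>x. s \<le> x \<Longrightarrow> ereal (w x) \<le> l"
      using increasing_ereal_limit[of s w] mono by metis
    have "ereal (c * r powr \<gamma>) \<le> \<bar>ereal (w r) - l\<bar>" if "r \<ge> s" for r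
      using l(2)[of "2 * r"] doubling'[OF that] that s by (cases l) auto
    then show ?thesis
      unfolding condition_L_def using 3 s c l(1)
      by (intro exI[of _ c] exI[of _ s] conjI) (auto simp: \<gamma>_def)
  next
    case 4
    then show ?thesis
      unfolding condition_L_def by (intro exI[of _ 1] conjI) auto
  qed
qed

text \<open>The exponent is negative for \<open>N \<ge> 3\<close>, so the increments give a Cauchy
  property, and letting \<open>t\<close> tend to infinity in them gives the rate.\<close>

lemma condition_S_if_powr_decay:
  fixes w :: "real \<Rightarrow> real"
  assumes N: "N \<ge> 3" and s1: "s1 \<ge> 1" and C: "C > 0" and w: "continuous_on {1..} w"
    and diff: "\<And>s t. s1 \<le> s \<Longrightarrow> s < t \<Longrightarrow> \<bar>w t - w s\<bar> \<le> C * s powr (- real N / 2 - sqrt (real N - 1) + 2)"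
  shows "condition_S N w"
proof -
  define \<gamma> where "\<gamma> = - real N / 2 - sqrt (real N - 1) + 2"
  have diff': "\<bar>w t - w s\<bar> \<le> C * s powr \<gamma>" if "s1 \<le> s" "s \<le> t" for s t
    using diff[of s t] that C by (cases "s = t") (auto simp: \<gamma>_def)
  have "1 < sqrt (real N - 1)"
    using N by simp
  then have \<gamma>: "\<gamma> < 0"
    using N unfolding \<gamma>_def by linarith
  have lim0: "((\<lambda>s. C * s powr \<gamma>) \<longlongrightarrow> 0) at_top"
    using tendsto_mult_right_zero[OF tendsto_neg_powr[OF \<gamma> filterlim_ident]] .
  \<comment> \<open>One sequence is enough to find the limit; the bound on increments then extends
    the estimate to all real \<open>s \<ge> s1\<close>.\<close>
  define X where "X n = w (s1 + real n)" for n
  have "Cauchy X"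
  proof (rule CauchyI')
    fix e :: real assume "e > 0"
    have "filterlim (\<lambda>n. s1 + real n) at_top sequentially"
      by (intro filterlim_tendsto_add_at_top[OF tendsto_const] filterlim_real_sequentially)
    from filterlim_compose[OF lim0 this] have "(\<lambda>n. C * (s1 + real n) powr \<gamma>) \<longlonglongrightarrow> 0" .
    then have "\<forall>\<^sub>F n in sequentially. C * (s1 + real n) powr \<gamma> < e"
      using \<open>e > 0\<close> by (rule order_tendstoD(2))
    then obtain n0 where n0: "\<And>n. n \<ge> n0 \<Longrightarrow> C * (s1 + real n) powr \<gamma> < e"
      by (auto simp: eventually_sequentially)
    have "dist (X m) (X n) < e" if "m \<ge> n0" "n > m" for m n
      using diff'[of "s1 + real m" "s1 + real n"] n0[OF that(1)] that
      by (simp add: X_def dist_real_def abs_minus_commute)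
    then show "\<exists>M. \<forall>m\<ge>M. \<forall>n>m. dist (X m) (X n) < e"
      by blast
  qed
  then obtain l where l: "X \<longlonglongrightarrow> l"
    using Cauchy_convergent_iff convergent_def by blast
  have far: "\<bar>w s - l\<bar> \<le> C * s powr \<gamma>" if "s \<ge> s1" for s
  proof -
    have "(\<lambda>n. \<bar>X n - w s\<bar>) \<longlonglongrightarrow> \<bar>l - w s\<bar>"
      by (intro tendsto_intros l)
    moreover have "\<exists>n0. \<forall>n\<ge>n0. \<bar>X n - w s\<bar> \<le> C * s powr \<gamma>"
    proof -
      obtain n0 :: nat where "s \<le> real n0"
        using real_arch_simple by blast
      then show ?thesis
        using s1 that by (intro exI[of _ n0]) (auto simp: X_def intro!: diff')
    qed
    ultimately have "\<bar>l - w s\<bar> \<le> C * s powr \<gamma>"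
      by (rule LIMSEQ_le_const2)
    then show ?thesis
      by (simp only: abs_minus_commute)
  qed
  have lim: "has_limit_at_infinity w (ereal l)"
    unfolding has_limit_at_infinity_def
  proof (rule tendsto_ereal[OF LIM_zero_cancel])
    show "((\<lambda>x. w x - l) \<longlongrightarrow> 0) at_top"
      by (rule Lim_null_comparison[OF eventually_mono[OF eventually_ge_at_top[of s1]] lim0])
        (use far in simp)
  qed
  have "compact (w ` {1..s1})"
    using w by (intro compact_continuous_image continuous_on_subset[OF w]) auto
  from compact_imp_bounded[OF this]
  obtain B where B: "B > 0" "\<And>x. x \<in> {1..s1} \<Longrightarrow> \<bar>w x\<bar> \<le> B"
    unfolding bounded_pos by auto
  \<comment> \<open>The second summand pays for \<open>1 \<le> r < s1\<close>, where
    \<open>r powr \<gamma>\<close> is at least \<open>s1 powr \<gamma>\<close>.\<close>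
  define M where "M = C + (B + \<bar>l\<bar>) / s1 powr \<gamma>"
  have s1_pos: "s1 powr \<gamma> > 0"
    using s1 by simp
  have M: "M > 0" "M \<ge> C" "M * s1 powr \<gamma> \<ge> B + \<bar>l\<bar>"
    using B C s1_pos by (auto simp: M_def field_simps intro!: add_pos_nonneg)
  have "\<bar>w r - l\<bar> \<le> M * r powr \<gamma>" if "r \<ge> 1" for r
  proof (cases "r \<ge> s1")
    case True
    have "C * r powr \<gamma> \<le> M * r powr \<gamma>"
      using M by (intro mult_right_mono) auto
    then show ?thesis
      using far[OF True] by linarith
  next
    case False
    have "s1 powr \<gamma> \<le> r powr \<gamma>"
      using False that \<gamma> by (intro powr_mono2') auto
    then have "M * s1 powr \<gamma> \<le> M * r powr \<gamma>"
      using M by simp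
    moreover have "\<bar>w r\<bar> \<le> B"
      using B False that by simp
    ultimately show ?thesis
      using M by linarith
  qed
  then show ?thesis
    unfolding condition_S_def using N M(1) lim
    by (intro exI[of _ M] exI[of _ "ereal l"] conjI impI) (auto simp: \<gamma>_def)
qed

text \<open>For \<open>r \<ge> 2\<close> the logarithm is at least \<open>ln 2\<close>, so a
  multiple of it absorbs the values of \<open>w\<close> on the compact range up to
  \<open>s1\<close>.\<close>

lemma condition_S_if_log_bound:
  fixes w :: "real \<Rightarrow> real"
  assumes s1: "s1 \<ge> 2" and C: "C > 0" and w: "continuous_on {1..} w"
    and diff: "\<And>t. s1 < t \<Longrightarrow> \<bar>w t - w s1\<bar> \<le> C * ln t"
  shows "condition_S 2 w"
proof -
  have "compact (w ` {1..s1})"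
    using w by (intro compact_continuous_image continuous_on_subset[OF w]) auto
  from compact_imp_bounded[OF this]
  obtain B where B: "B > 0" "\<And>x. x \<in> {1..s1} \<Longrightarrow> \<bar>w x\<bar> \<le> B"
    unfolding bounded_pos by auto
  define M where "M = C + B / ln 2"
  have M: "M > 0"
    using B C by (simp add: M_def add_pos_pos)
  have "\<bar>w r\<bar> \<le> M * ln r" if "r \<ge> 2" for r
  proof -
    have "B = B / ln 2 * ln 2"
      by simp
    also have "\<dots> \<le> B / ln 2 * ln r"
      using that B by (intro mult_left_mono) auto
    finally have "B \<le> B / ln 2 * ln r" .
    moreover have "\<bar>w r\<bar> \<le> C * ln r + B"
    proof (cases "r > s1")
      case True
      then show ?thesis
        using diff[OF True] B(2)[of s1] s1 by simp
    next
      case False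
      have "0 \<le> C * ln r"
        using C that by simp
      then show ?thesis
        using B(2)[of r] False that by simp
    qed
    ultimately show ?thesis
      by (simp add: M_def algebra_simps)
  qed
  then show ?thesis
    unfolding condition_S_def using M by (intro exI[of _ M]) auto
qed

text \<open>Young's inequality \<open>2 * \<bar>z\<bar> \<le> \<mu> * p * z\<^sup>2 + 1 / (\<mu> *
  p)\<close> under the integral. The free \<open>\<mu>\<close> replaces the square roots of
  Cauchy-Schwarz and is chosen later to balance the two terms.\<close>

lemma abs_diff_le_weighted:
  fixes w z p :: "real \<Rightarrow> real"
  assumes st: "s < t" and w: "\<And>x. x \<in> {s..t} \<Longrightarrow> (w has_real_derivative z x) (at x within {s..t})"
    and z: "continuous_on {s..t} z" and p: "continuous_on {s..t} p" "\<And>x. x \<in> {s..t} \<Longrightarrow> 0 < p x" and lam: "\<mu> > 0"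
  shows "2 * \<bar>w t - w s\<bar> \<le> \<mu> * integral {s..t} (\<lambda>x. p x * (z x)\<^sup>2) + integral {s..t} (\<lambda>x. 1 / p x) / \<mu>"
proof -
  have int: "(z has_integral w t - w s) {s..t}"
    using st w by (intro fundamental_theorem_of_calculus)
      (auto simp: has_real_derivative_iff_has_vector_derivative)
  have cont_p: "continuous_on {s..t} (\<lambda>x. 1 / p x)"
    using p by (intro continuous_on_divide continuous_intros) (metis less_irrefl)+
  have i1: "(\<lambda>x. p x * (z x)\<^sup>2) integrable_on {s..t}"
    by (intro integrable_continuous_real continuous_intros z p)
  have i2: "(\<lambda>x. 1 / p x) integrable_on {s..t}"
    by (intro integrable_continuous_real cont_p)
  have "norm (integral {s..t} z) \<le> integral {s..t} (\<lambda>x. \<mu> / 2 * (p x * (z x)\<^sup>2) + 1 / (2 * \<mu>) * (1 / p x))"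
  proof (rule integral_norm_bound_integral)
    show "z integrable_on {s..t}"
      using int by blast
    show "(\<lambda>x. \<mu> / 2 * (p x * (z x)\<^sup>2) + 1 / (2 * \<mu>) * (1 / p x)) integrable_on {s..t}"
      using i1 i2 by (intro integrable_add integrable_on_mult_right)
    fix x assume "x \<in> {s..t}"
    then have px: "p x > 0"
      by (rule p)
    have "0 \<le> (\<mu> * p x * \<bar>z x\<bar> - 1)\<^sup>2 / (2 * \<mu> * p x)"
      using px lam by simp
    also have "\<dots> = \<mu> / 2 * (p x * (z x)\<^sup>2) + 1 / (2 * \<mu>) * (1 / p x) - \<bar>z x\<bar>"
      using px lam by (simp add: power2_diff power_mult_distrib field_simps) (simp add: power2_eq_square)
    finally show "norm (z x) \<le> \<mu> / 2 * (p x * (z x)\<^sup>2) + 1 / (2 * \<mu>) * (1 / p x)"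
      by simp
  qed
  also have "\<dots> = integral {s..t} (\<lambda>x. \<mu> / 2 * (p x * (z x)\<^sup>2)) + integral {s..t} (\<lambda>x. 1 / (2 * \<mu>) * (1 / p x))"
    using i1 i2 by (intro integral_add integrable_on_mult_right)
  also have "\<dots> = \<mu> / 2 * integral {s..t} (\<lambda>x. p x * (z x)\<^sup>2) + 1 / (2 * \<mu>) * integral {s..t} (\<lambda>x. 1 / p x)"
    by (simp only: integral_mult_right)
  finally show ?thesis
    using integral_unique[OF int] lam by (simp add: field_simps)
qed

section \<open>The profile of a solution and the choice between (L) and (S)\<close>

locale radial_weight =
  fixes w z z' :: "real \<Rightarrow> real" and N :: nat and R :: real
  assumes N: "N \<ge> 2"
    and w_deriv: "\<And>x. (w has_real_derivative z x) (at x)"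
    and z_deriv: "\<And>x. 0 < x \<Longrightarrow> (z has_real_derivative z' x) (at x)"
    and z'_cont: "continuous_on {0<..} z'"
    and hardy: "hardy_weight (\<lambda>x. x ^ (N - 1) * (z x)\<^sup>2) R (sqrt (real N - 1))"
begin

sublocale hardy_weight "\<lambda>x. x ^ (N - 1) * (z x)\<^sup>2" R "sqrt (real N - 1)"
  by (rule hardy)

lemma z_cont: "S \<subseteq> {0<..} \<Longrightarrow> continuous_on S z"
  using z_deriv by (meson DERIV_isCont continuous_at_imp_continuous_on greaterThan_iff subset_eq)

lemma w_cont: "continuous_on S w"
  using w_deriv by (meson DERIV_isCont continuous_at_imp_continuous_on)

text \<open>A zero \<open>x\<^sub>0\<close> of \<open>z\<close> is a double zero of the weight \<open>\<phi>\<close>, so \<open>\<integral> 1 / (\<phi> + \<delta>\<^sup>2)\<close> over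
  \<open>[x\<^sub>0, x\<^sub>0 + \<delta>]\<close> is of order \<open>1 / \<delta>\<close>.\<close>

lemma z_nonzero:
  assumes x0: "x0 > 0"
    and bound: "\<And>t p. x0 < t \<Longrightarrow> continuous_on {x0..t} p \<Longrightarrow> (\<And>x. x \<in> {x0..t} \<Longrightarrow> 0 < p x) \<Longrightarrow>
       (\<And>x. x \<in> {x0..t} \<Longrightarrow> x ^ (N - 1) * (z x)\<^sup>2 \<le> p x) \<Longrightarrow> integral {x0..t} (\<lambda>x. 1 / p x) \<le> B"
  shows "z x0 \<noteq> 0"
proof
  assume zero: "z x0 = 0"
  have "\<exists>L. L-lipschitz_on {x0..x0 + 1} z"
    using x0 by (intro lipschitz_on_has_real_derivative[of _ _ _ z'] continuous_on_subset[OF z'_cont])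
      (auto intro: has_field_derivative_at_within[OF z_deriv])
  then obtain L where L: "L-lipschitz_on {x0..x0 + 1} z"
    by blast
  define K where "K = (x0 + 1) ^ (N - 1) * L\<^sup>2"
  have K: "K \<ge> 0"
    using x0 by (simp add: K_def)
  have le: "x ^ (N - 1) * (z x)\<^sup>2 \<le> K * (x - x0)\<^sup>2" if "x \<in> {x0..x0 + 1}" for x
  proof -
    have "\<bar>z x\<bar> \<le> L * \<bar>x - x0\<bar>"
      using lipschitz_onD[OF L that, of x0] zero by (simp add: dist_real_def)
    from power_mono[OF this, of 2] have "(z x)\<^sup>2 \<le> (L * (x - x0))\<^sup>2"
      by (simp add: power_mult_distrib)
    moreover have "x ^ (N - 1) \<le> (x0 + 1) ^ (N - 1)"
      using that x0 by (intro power_mono) auto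
    ultimately have "x ^ (N - 1) * (z x)\<^sup>2 \<le> (x0 + 1) ^ (N - 1) * (L * (x - x0))\<^sup>2"
      using x0 by (intro mult_mono) auto
    then show ?thesis
      by (simp add: K_def power_mult_distrib mult.assoc)
  qed
  \<comment> \<open>Small enough for the lower bound \<open>1 / ((K + 1) * \<delta>)\<close> of the
    integral to exceed \<open>B\<close>, and at most 1 so that the quadratic bound \<open>le\<close>
    covers the interval.\<close>
  define \<delta> where "\<delta> = min 1 (1 / ((K + 1) * (\<bar>B\<bar> + 1)))"
  have \<delta>: "0 < \<delta>" "\<delta> \<le> 1" "\<delta> \<le> 1 / ((K + 1) * (\<bar>B\<bar> + 1))"
    using K by (auto simp: \<delta>_def)
  let ?p = "\<lambda>x. x ^ (N - 1) * (z x)\<^sup>2 + \<delta>\<^sup>2"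
  have pos: "0 < ?p x" if "x \<in> {x0..x0 + \<delta>}" for x
    using that x0 \<delta> by (intro add_nonneg_pos) auto
  have cont: "continuous_on {x0..x0 + \<delta>} ?p"
    using x0 by (intro continuous_intros z_cont) auto
  have "integral {x0..x0 + \<delta>} (\<lambda>x. 1 / ?p x) \<le> B"
    using pos cont \<delta> by (intro bound) auto
  moreover have "integral {x0..x0 + \<delta>} (\<lambda>x. 1 / ((K + 1) * \<delta>\<^sup>2)) \<le> integral {x0..x0 + \<delta>} (\<lambda>x. 1 / ?p x)"
  proof (rule integral_le)
    show "(\<lambda>x. 1 / ?p x) integrable_on {x0..x0 + \<delta>}"
      using pos by (intro integrable_continuous_real continuous_on_divide continuous_on_const cont ballI)
        (rule less_imp_neq[symmetric])
    fix x assume x: "x \<in> {x0..x0 + \<delta>}"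
    have "(x - x0)\<^sup>2 \<le> \<delta>\<^sup>2"
      using x by (intro power_mono) auto
    then have "K * (x - x0)\<^sup>2 \<le> K * \<delta>\<^sup>2"
      using K by (rule mult_left_mono)
    then have "?p x \<le> (K + 1) * \<delta>\<^sup>2"
      using le[of x] x \<delta> by (simp add: algebra_simps)
    then show "1 / ((K + 1) * \<delta>\<^sup>2) \<le> 1 / ?p x"
      using pos[OF x] by (intro divide_left_mono) (auto intro!: mult_pos_pos)
  qed auto
  moreover have "integral {x0..x0 + \<delta>} (\<lambda>x. 1 / ((K + 1) * \<delta>\<^sup>2)) = 1 / ((K + 1) * \<delta>)"
    using \<delta> by (simp add: power2_eq_square)
  moreover have "\<bar>B\<bar> + 1 \<le> 1 / ((K + 1) * \<delta>)"
  proof -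
    have "0 < (K + 1) * (\<bar>B\<bar> + 1)" "0 < (K + 1) * \<delta>"
      using K \<delta>(1) by (auto intro!: mult_pos_pos)
    then show ?thesis
      using \<delta>(3) by (simp add: pos_le_divide_eq mult_ac)
  qed
  ultimately show False
    by linarith
qed

text \<open>The pointwise bound \<open>3 \<le> 2 \<mu> v' + 1 / (\<mu> v')\<^sup>2\<close> is the arithmetic-geometric mean inequality.\<close>

lemma doubling_lower_bound:
  fixes v :: "real \<Rightarrow> real"
  assumes r: "r > 0" and \<beta>: "\<beta> > 0"
    and v: "\<And>x. x \<in> {r..2 * r} \<Longrightarrow> (v has_real_derivative v' x) (at x within {r..2 * r})"
    and pos: "\<And>x. x \<in> {r..2 * r} \<Longrightarrow> v' x > 0" and sq: "\<And>x. (v' x)\<^sup>2 = (z x)\<^sup>2"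
    and cont: "continuous_on {r..2 * r} v'"
    and bound: "integral {r..2 * r} (\<lambda>x. 1 / (x ^ (N - 1) * (z x)\<^sup>2)) \<le> 1 / (\<beta> * r powr (2 * sqrt (real N - 1)))"
  shows "sqrt (\<beta> / 2 ^ (N - 1)) * r powr (- real N / 2 + sqrt (real N - 1) + 2) \<le> v (2 * r) - v r"
proof -
  define a where "a = sqrt (real N - 1)"
  define k where "k = sqrt (2 ^ (N - 1) / \<beta>)"
  have k: "k > 0" "k\<^sup>2 = 2 ^ (N - 1) / \<beta>"
    using \<beta> by (auto simp: k_def)
  \<comment> \<open>Tuned so that the term with \<open>1 / \<mu>\<^sup>2\<close> is at most
    \<open>r\<close>. Then \<open>3 * r\<close> on the left leaves
    \<open>2 * r \<le> 2 * \<mu> * (v (2 * r) - v r)\<close>.\<close>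
  define \<mu> where "\<mu> = k * r powr (real N / 2 - 1 - a)"
  have lam: "\<mu> > 0"
    using k r by (simp add: \<mu>_def)
  have int: "(v' has_integral v (2 * r) - v r) {r..2 * r}"
    using r v by (intro fundamental_theorem_of_calculus)
      (auto simp: has_real_derivative_iff_has_vector_derivative)
  have cont1: "continuous_on {r..2 * r} (\<lambda>x. 1 / (v' x)\<^sup>2)"
    using pos by (intro continuous_on_divide continuous_on_const continuous_on_power cont) fastforce
  have cont2: "continuous_on {r..2 * r} (\<lambda>x. 1 / (x ^ (N - 1) * (z x)\<^sup>2))"
    unfolding sq[symmetric] using pos r
    by (intro continuous_on_divide continuous_intros cont) fastforce
  have "integral {r..2 * r} (\<lambda>x. 3) \<le> integral {r..2 * r} (\<lambda>x. 2 * \<mu> * v' x + 1 / \<mu>\<^sup>2 * (1 / (v' x)\<^sup>2))"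
  proof (rule integral_le)
    show "(\<lambda>x. 2 * \<mu> * v' x + 1 / \<mu>\<^sup>2 * (1 / (v' x)\<^sup>2)) integrable_on {r..2 * r}"
      by (intro integrable_continuous_real continuous_on_add continuous_on_mult_left cont cont1)
    fix x assume x: "x \<in> {r..2 * r}"
    define y where "y = \<mu> * v' x"
    have y: "y > 0"
      using lam pos[OF x] by (simp add: y_def)
    have "0 \<le> (y - 1)\<^sup>2 * (2 * y + 1) / y\<^sup>2"
      using y by simp
    also have "\<dots> = 2 * y + 1 / y\<^sup>2 - 3"
      using y by (simp add: field_simps power2_eq_square)
    finally show "3 \<le> 2 * \<mu> * v' x + 1 / \<mu>\<^sup>2 * (1 / (v' x)\<^sup>2)"
      by (simp add: y_def power_mult_distrib)
  qed auto
  also have "\<dots> = integral {r..2 * r} (\<lambda>x. 2 * \<mu> * v' x) + integral {r..2 * r} (\<lambda>x. 1 / \<mu>\<^sup>2 * (1 / (v' x)\<^sup>2))"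
    by (intro integral_add integrable_continuous_real continuous_on_mult_left cont cont1)
  also have "\<dots> = 2 * \<mu> * (v (2 * r) - v r) + 1 / \<mu>\<^sup>2 * integral {r..2 * r} (\<lambda>x. 1 / (v' x)\<^sup>2)"
    using integral_unique[OF int] by (simp only: integral_mult_right)
  also have "integral {r..2 * r} (\<lambda>x. 1 / (v' x)\<^sup>2) \<le>
      integral {r..2 * r} (\<lambda>x. (2 * r) ^ (N - 1) * (1 / (x ^ (N - 1) * (z x)\<^sup>2)))"
  proof (intro integral_le integrable_continuous_real continuous_on_mult_left cont1 cont2)
    fix x assume x: "x \<in> {r..2 * r}"
    have "x ^ (N - 1) \<le> (2 * r) ^ (N - 1)"
      using x r by (intro power_mono) auto
    then have "1 * (1 / (v' x)\<^sup>2) \<le> (2 * r) ^ (N - 1) / x ^ (N - 1) * (1 / (v' x)\<^sup>2)"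
      using x r by (intro mult_right_mono) auto
    then show "1 / (v' x)\<^sup>2 \<le> (2 * r) ^ (N - 1) * (1 / (x ^ (N - 1) * (z x)\<^sup>2))"
      by (simp add: sq)
  qed
  also have "\<dots> = (2 * r) ^ (N - 1) * integral {r..2 * r} (\<lambda>x. 1 / (x ^ (N - 1) * (z x)\<^sup>2))"
    by (rule integral_mult_right)
  also have "\<dots> \<le> (2 * r) ^ (N - 1) * (1 / (\<beta> * r powr (2 * a)))"
    using bound r unfolding a_def by (intro mult_left_mono) auto
  finally have "3 * r \<le> 2 * \<mu> * (v (2 * r) - v r) + 1 / \<mu>\<^sup>2 * ((2 * r) ^ (N - 1) * (1 / (\<beta> * r powr (2 * a))))"
    using lam r by (simp add: divide_right_mono)
  also have "1 / \<mu>\<^sup>2 * ((2 * r) ^ (N - 1) * (1 / (\<beta> * r powr (2 * a)))) = r"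
  proof -
    have "\<mu>\<^sup>2 = k\<^sup>2 * r powr (real N - 2 - 2 * a)"
      by (simp add: \<mu>_def power_mult_distrib power2_eq_square[of "r powr _"] powr_add[symmetric] algebra_simps)
    also have "r powr (real N - 2 - 2 * a) = r ^ (N - 1) / (r * r powr (2 * a))"
    proof -
      have "r ^ (N - 1) = r powr (real N - 1)"
        using r N by (simp add: powr_realpow[symmetric])
      moreover have "r powr (real N - 1) = r powr (real N - 2 - 2 * a + 1 + 2 * a)"
        by simp
      ultimately show ?thesis
        using r by (simp only: powr_add) simp
    qed
    finally have "(2 * r) ^ (N - 1) = r * (\<mu>\<^sup>2 * (\<beta> * r powr (2 * a)))"
      using r \<beta> by (simp add: k power_mult_distrib)
    then show ?thesis
      using r \<beta> lam by simp
  qed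
  finally have "r / \<mu> \<le> v (2 * r) - v r"
    using lam by (simp add: field_simps)
  moreover have "r / \<mu> = 1 / k * r powr (- real N / 2 + a + 2)"
  proof -
    have "r powr (- real N / 2 + a + 2) * r powr (real N / 2 - 1 - a) = r"
      using r by (simp add: powr_add[symmetric])
    then show ?thesis
      using k r by (simp add: \<mu>_def field_simps)
  qed
  moreover have "1 / k = sqrt (\<beta> / 2 ^ (N - 1))"
    by (simp add: k_def real_sqrt_divide)
  ultimately show ?thesis
    by (simp add: a_def)
qed

lemma condition_L_or_S: "condition_L N w \<or> condition_S N w"
proof -
  define a where "a = sqrt (real N - 1)"
  have a2: "a\<^sup>2 = real N - 1"
    using N by (simp add: a_def)
  \<comment> \<open>The bound 3 exceeds \<open>exp 1\<close>, so that \<open>ln t \<ge> 1\<close>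
    for \<open>t > s1\<close> in the case \<open>N = 2\<close>.\<close>
  define s1 where "s1 = max 3 (R + 1)"
  have s1: "R < s1" "s1 \<ge> 3"
    by (auto simp: s1_def)
  show ?thesis
    using s1(1)
  proof (cases rule: dichotomy)
    case (grow s0 \<beta>)
    \<comment> \<open>The bound with \<open>s = x\<close> is the same for all \<open>t\<close> and
      all majorants \<open>p\<close>, which rules out a zero at \<open>x\<close>.\<close>
    have z_ne: "z x \<noteq> 0" if "s0 \<le> x" for x
      using grow(3)[of x] that s1 grow(1) by (intro z_nonzero) auto
    have phi_pos: "0 < x ^ (N - 1) * (z x)\<^sup>2" if "s0 \<le> x" for x
      using z_ne[OF that] that s1 grow(1) by simp
    \<comment> \<open>\<open>v\<close> will be \<open>w\<close> or \<open>- w\<close>, whichever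
      increases: \<open>z\<close> is continuous without zeros beyond \<open>s0\<close>, so it keeps
      one sign there.\<close>
    have main: "condition_L N v" if pos: "\<And>x. s0 \<le> x \<Longrightarrow> 0 < v' x" and sq: "\<And>x. (v' x)\<^sup>2 = (z x)\<^sup>2"
        and der: "\<And>x. (v has_real_derivative v' x) (at x)" and cont: "continuous_on {s0..} v'" for v v'
    proof (rule condition_L_if_doubling)
      show "1 \<le> s0" "0 < sqrt (\<beta> / 2 ^ (N - 1))"
        using s1 grow by auto
      show "v x \<le> v y" if "s0 \<le> x" "x \<le> y" for x y
        using that pos by (intro DERIV_nonneg_imp_nondecreasing[of x y v]) (meson der less_imp_le order_trans)+
      fix r assume r: "s0 \<le> r"
      show "sqrt (\<beta> / 2 ^ (N - 1)) * r powr (- real N / 2 + sqrt (real N - 1) + 2) \<le> v (2 * r) - v r"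
      proof (rule doubling_lower_bound)
        show "integral {r..2 * r} (\<lambda>x. 1 / (x ^ (N - 1) * (z x)\<^sup>2)) \<le> 1 / (\<beta> * r powr (2 * sqrt (real N - 1)))"
          using r s1 grow(1) by (intro grow(3) phi_pos continuous_intros z_cont) auto
        show "continuous_on {r..2 * r} v'"
          by (rule continuous_on_subset[OF cont]) (use r in auto)
      qed (use r s1 grow pos sq der in \<open>auto intro: has_field_derivative_at_within[OF der]\<close>)
    qed
    have cont: "continuous_on {s0..} z"
      using s1 grow(1) by (intro z_cont) auto
    consider "\<And>x. s0 \<le> x \<Longrightarrow> 0 < z x" | "\<And>x. s0 \<le> x \<Longrightarrow> z x < 0"
    proof -
      have "connected (z ` {s0..})"
        using cont by (intro connected_continuous_image) auto
      then have "\<not> (z x < 0 \<and> 0 < z y)" if "s0 \<le> x" "s0 \<le> y" for x y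
        using connectedD_interval[of "z ` {s0..}" "z x" "z y" 0] z_ne that by force
      then show thesis
        using that z_ne by (metis linorder_neqE_linordered_idom)
    qed
    then have "condition_L N w"
    proof cases
      case 1
      then show ?thesis
        using cont w_deriv by (intro main[of z]) auto
    next
      case 2
      then have "condition_L N (\<lambda>r. - w r)"
        using cont w_deriv by (intro main[of "\<lambda>x. - z x"] continuous_intros DERIV_minus) auto
      from condition_L_uminus[OF this] show ?thesis
        by simp
    qed
    then show ?thesis ..
  next
    case (decay C)
    have decay': "(a\<^sup>2 - \<kappa>\<^sup>2) * integral {s..t} (\<lambda>x. x ^ (N - 1) * (z x)\<^sup>2 * x powr (2 * \<kappa> - 2)) \<le> C * s powr (2 * \<kappa> - 2 * a)"
      if "s1 \<le> s" "s < t" for s t \<kappa>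
      using decay(2)[OF that] by (simp add: a_def)
    have w_within: "(w has_real_derivative z x) (at x within S)" for x S
      using w_deriv by (rule has_field_derivative_at_within)
    have "condition_S N w"
    proof (cases "N = 2")
      case True
      then have a: "a = 1"
        by (simp add: a_def)
      have "\<bar>w t - w s1\<bar> \<le> (exp 2 * C + 1) * ln t" if t: "s1 < t" for t
      proof -
        have pos: "s1 > 0" "t > 0"
          using t s1 by auto
        have "exp 1 \<le> t"
          using exp_le t s1 by linarith
        then have ln_t: "ln t \<ge> 1"
          using pos by (simp add: ln_ge_iff)
        \<comment> \<open>Here \<open>a = 1\<close>, so \<open>\<kappa> = 1\<close> would make
          \<open>a\<^sup>2 - \<kappa>\<^sup>2\<close> vanish. At distance \<open>1 / ln t\<close>
          this factor is at least \<open>1 / ln t\<close>, while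
          \<open>x powr (2 * \<kappa> - 2)\<close> is still at least \<open>exp (- 2)\<close> on
          \<open>[s1, t]\<close>.\<close>
        define \<kappa> where "\<kappa> = 1 - 1 / ln t"
        have \<kappa>: "0 \<le> \<kappa>" "\<kappa> \<le> 1"
          using ln_t by (auto simp: \<kappa>_def)
        let ?I = "integral {s1..t} (\<lambda>x. x * (z x)\<^sup>2)"
        have cont: "continuous_on {s1..t} z"
          using pos by (intro z_cont) auto
        have I: "0 \<le> ?I"
          using pos by (intro integral_nonneg integrable_continuous_real continuous_intros cont) auto
        have "exp (- 2) * ?I = integral {s1..t} (\<lambda>x. exp (- 2) * (x * (z x)\<^sup>2))"
          by (rule integral_mult_right[symmetric])
        also have "\<dots> \<le> integral {s1..t} (\<lambda>x. x * (z x)\<^sup>2 * x powr (2 * \<kappa> - 2))"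
        proof (rule integral_le)
          fix x assume x: "x \<in> {s1..t}"
          have "exp (- 2) = t powr (2 * \<kappa> - 2)"
            using pos t s1 by (simp add: powr_def \<kappa>_def)
          also have "\<dots> \<le> x powr (2 * \<kappa> - 2)"
            using x pos \<kappa> by (intro powr_mono2') auto
          finally have "(x * (z x)\<^sup>2) * exp (- 2) \<le> (x * (z x)\<^sup>2) * x powr (2 * \<kappa> - 2)"
            using x pos by (intro mult_left_mono) auto
          then show "exp (- 2) * (x * (z x)\<^sup>2) \<le> x * (z x)\<^sup>2 * x powr (2 * \<kappa> - 2)"
            by (simp only: mult.commute)
        qed (use pos in \<open>auto intro!: integrable_continuous_real continuous_intros cont\<close>)
        finally have 1: "exp (- 2) * ?I \<le> integral {s1..t} (\<lambda>x. x * (z x)\<^sup>2 * x powr (2 * \<kappa> - 2))" .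
        have "1 / ln t * 1 \<le> (1 - \<kappa>) * (1 + \<kappa>)"
          using \<kappa> ln_t by (intro mult_mono) (auto simp: \<kappa>_def)
        then have "1 / ln t * (exp (- 2) * ?I) \<le> (a\<^sup>2 - \<kappa>\<^sup>2) * (exp (- 2) * ?I)"
          using I by (intro mult_right_mono) (auto simp: a algebra_simps power2_eq_square)
        also have "\<dots> \<le> (a\<^sup>2 - \<kappa>\<^sup>2) * integral {s1..t} (\<lambda>x. x * (z x)\<^sup>2 * x powr (2 * \<kappa> - 2))"
          using 1 \<kappa> by (intro mult_left_mono) (auto simp: a power_le_one)
        also have "\<dots> \<le> C * s1 powr (2 * \<kappa> - 2 * a)"
          using decay'[of s1 t \<kappa>] t True by simp
        also have "\<dots> \<le> C * s1 powr 0"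
          using s1 \<kappa> decay(1) by (intro mult_left_mono powr_mono) (auto simp: a)
        finally have "exp (- 2) * ?I / ln t \<le> C"
          using pos by simp
        moreover have "0 < ln t"
          using ln_t by linarith
        ultimately have "exp (- 2) * ?I \<le> C * ln t"
          by (simp only: pos_divide_le_eq)
        then have I_le: "?I \<le> exp 2 * C * ln t"
          by (simp add: exp_minus field_simps)
        \<comment> \<open>With \<open>\<mu> = 1\<close> and \<open>p x = x\<close> both terms are at
          most of order \<open>ln t\<close>.\<close>
        have "2 * \<bar>w t - w s1\<bar> \<le> 1 * ?I + integral {s1..t} (\<lambda>x. 1 / x) / 1"
          using t pos by (intro abs_diff_le_weighted w_within cont) (auto intro!: continuous_intros)
        moreover have "((\<lambda>x. 1 / x) has_integral ln t - ln s1) {s1..t}"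
          using t pos by (intro fundamental_theorem_of_calculus)
            (auto simp: has_real_derivative_iff_has_vector_derivative[symmetric] intro!: derivative_eq_intros)
        moreover have "ln s1 \<ge> 0"
          using s1 by simp
        moreover have "0 \<le> exp 2 * C * ln t"
          using decay(1) ln_t by simp
        ultimately show ?thesis
          using I_le ln_t by (simp add: integral_unique algebra_simps)
      qed
      then have "condition_S 2 w"
        using s1 decay(1) by (intro condition_S_if_log_bound[of s1 "exp 2 * C + 1"] w_cont add_pos_pos) auto
      then show ?thesis
        using True by simp
    next
      case False
      then have N3: "N \<ge> 3"
        using N by simp
      show ?thesis
      proof (rule condition_S_if_powr_decay[OF N3])
        show "1 \<le> s1" "0 < C + 1"
          using s1 decay(1) by auto
        show "continuous_on {1..} w"
          by (rule w_cont)
        fix s t assume st: "s1 \<le> s" "s < t"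
        then have pos: "0 < s" "0 < t"
          using s1 by auto
        define \<gamma> where "\<gamma> = - real N / 2 - a + 2"
        let ?I = "integral {s..t} (\<lambda>x. x ^ (N - 1) * (z x)\<^sup>2)"
        have cont: "continuous_on {s..t} z"
          using pos by (intro z_cont) auto
        have I: "0 \<le> ?I"
          using pos by (intro integral_nonneg integrable_continuous_real continuous_intros cont) auto
        \<comment> \<open>The choice \<open>\<kappa> = 1\<close> removes the extra power of
          \<open>x\<close>, and the factor \<open>a\<^sup>2 - 1 = N - 2\<close> is at least
          1.\<close>
        have "integral {s..t} (\<lambda>x. x ^ (N - 1) * (z x)\<^sup>2 * x powr (2 * 1 - 2)) = ?I"
          using pos by (intro integral_cong) auto
        then have "(real N - 2) * ?I \<le> C * s powr (2 - 2 * a)"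
          using decay'[OF st, of 1] by (simp add: a2)
        moreover have "1 * ?I \<le> (real N - 2) * ?I"
          using I N3 by (intro mult_right_mono) auto
        ultimately have I_le: "?I \<le> C * s powr (2 - 2 * a)"
          by linarith
        \<comment> \<open>Balances the bounds \<open>s powr (2 - 2 * a)\<close> and
          \<open>s powr (2 - real N)\<close>: both terms become multiples of
          \<open>s powr \<gamma>\<close>.\<close>
        define \<mu> where "\<mu> = s powr (a - real N / 2)"
        have lam: "\<mu> > 0"
          using pos by (simp add: \<mu>_def)
        have J: "((\<lambda>x. 1 / x ^ (N - 1)) has_integral
            (- (t powr (2 - real N)) / (real N - 2)) - (- (s powr (2 - real N)) / (real N - 2))) {s..t}"
        proof (rule fundamental_theorem_of_calculus)
          fix x assume "x \<in> {s..t}"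
          then have x: "x > 0"
            using pos by auto
          have "2 - real N - 1 = - real (N - 1)"
            using N3 by simp
          then have "x powr (2 - real N - 1) = 1 / x ^ (N - 1)"
            by (simp only: powr_minus_divide powr_realpow[OF x])
          moreover have "((\<lambda>x. - (x powr (2 - real N)) / (real N - 2)) has_real_derivative
              - ((2 - real N) * x powr (2 - real N - 1)) / (real N - 2)) (at x within {s..t})"
            by (intro DERIV_cdivide DERIV_minus has_field_derivative_at_within[OF has_real_derivative_powr[OF x]])
          moreover have "- ((2 - real N) * y) / (real N - 2) = y" for y
            using N3 by (simp add: divide_simps) (simp add: algebra_simps)
          ultimately show "((\<lambda>x. - (x powr (2 - real N)) / (real N - 2)) has_vector_derivative 1 / x ^ (N - 1)) (at x within {s..t})"
            by (simp only: has_real_derivative_iff_has_vector_derivative)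
        qed (use st in simp)
        have "integral {s..t} (\<lambda>x. 1 / x ^ (N - 1)) \<le> s powr (2 - real N) / (real N - 2)"
          using integral_unique[OF J] N3 by simp
        also have "\<dots> \<le> s powr (2 - real N) / 1"
          using N3 by (intro divide_left_mono) auto
        finally have J_le: "integral {s..t} (\<lambda>x. 1 / x ^ (N - 1)) \<le> s powr (2 - real N)"
          by simp
        have "2 * \<bar>w t - w s\<bar> \<le> \<mu> * ?I + integral {s..t} (\<lambda>x. 1 / x ^ (N - 1)) / \<mu>"
          using st pos lam by (intro abs_diff_le_weighted w_within cont) (auto intro!: continuous_intros)
        also have "\<dots> \<le> \<mu> * (C * s powr (2 - 2 * a)) + s powr (2 - real N) / \<mu>"
          using I_le J_le lam by (intro add_mono mult_left_mono divide_right_mono) auto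
        also have "\<mu> * (C * s powr (2 - 2 * a)) = C * s powr \<gamma>"
          by (simp add: \<mu>_def \<gamma>_def powr_add[symmetric] mult.left_commute[of C] algebra_simps)
        also have "s powr (2 - real N) / \<mu> = s powr \<gamma>"
          by (simp add: \<mu>_def \<gamma>_def powr_diff[symmetric] algebra_simps)
        finally have "2 * \<bar>w t - w s\<bar> \<le> (C + 1) * s powr \<gamma>"
          by (simp add: algebra_simps)
        then have "\<bar>w t - w s\<bar> \<le> (C + 1) * s powr \<gamma>"
          by (rule order_trans[rotated]) simp
        then show "\<bar>w t - w s\<bar> \<le> (C + 1) * s powr (- real N / 2 - sqrt (real N - 1) + 2)"
          by (simp add: \<gamma>_def a_def)
      qed
    qed
    then show ?thesis ..
  qed
qed

end

subsection \<open>Radial functions\<close>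

text \<open>Polar coordinates for radial functions. Both measures give the half line up to
  \<open>a \<ge> 0\<close> the volume of the ball of radius \<open>a\<close>, and half lines
  generate the Borel sets.\<close>

lemma distr_lborel_norm:
  "distr (lborel :: 'a::euclidean_space measure) borel norm =
     density lborel (\<lambda>r. ennreal (unit_ball_vol (real DIM('a)) * real DIM('a) * r ^ (DIM('a) - 1)) * indicator {0..} r)"
  (is "?M = ?D")
proof (rule measure_eqI_generator_eq)
  let ?N = "DIM('a)" and ?\<omega> = "unit_ball_vol (real DIM('a))"
  let ?E = "range (\<lambda>a::real. {..a})"
  have M: "emeasure ?M {..a} = (if a \<ge> 0 then ennreal (?\<omega> * a ^ ?N) else 0)" for a
  proof -
    have "norm -` {..a} = cball (0::'a) a"
      by auto
    then show ?thesis
      by (auto simp: emeasure_distr emeasure_cball)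
  qed
  have D: "emeasure ?D {..a} = (if a \<ge> 0 then ennreal (?\<omega> * a ^ ?N) else 0)" for a
  proof -
    have "emeasure ?D {..a} =
      (\<integral>\<^sup>+r. ennreal (?\<omega> * real ?N * r ^ (?N - 1)) * indicator {0..a} r \<partial>lborel)"
      by (subst emeasure_density) (auto intro!: nn_integral_cong simp: indicator_def)
    also have "\<dots> = (if a \<ge> 0 then ennreal (?\<omega> * a ^ ?N) else 0)"
    proof (cases "a \<ge> 0")
      case True
      have "(\<integral>\<^sup>+r. ennreal (?\<omega> * real ?N * r ^ (?N - 1)) * indicator {0..a} r \<partial>lborel) =
          ennreal (?\<omega> * a ^ ?N - ?\<omega> * 0 ^ ?N)"
        by (rule nn_integral_FTC_Icc) (auto intro!: derivative_eq_intros True)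
      then show ?thesis
        using True by (simp add: zero_power)
    qed auto
    finally show ?thesis .
  qed
  show "Int_stable ?E"
    by (auto simp: Int_stable_def)
  show "?E \<subseteq> Pow UNIV" "sets ?M = sigma_sets UNIV ?E" "sets ?D = sigma_sets UNIV ?E"
    by (auto simp: borel_eq_atMost)
  show "emeasure ?M X = emeasure ?D X" if "X \<in> ?E" for X
    using that M D by auto
  show "range (\<lambda>n::nat. {..real n}) \<subseteq> ?E" "(\<Union>n::nat. {..real n}) = UNIV"
    by (auto intro: real_arch_simple)
  show "emeasure ?M {..real i} \<noteq> \<infinity>" for i
    by (simp add: M)
qed

lemma integral_lborel_norm:
  fixes F :: "real \<Rightarrow> real"
  assumes c: "0 \<le> c" and F: "continuous_on {c..d} F" and zero: "\<And>r. r \<notin> {c..d} \<Longrightarrow> F r = 0"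
  shows "(LINT x|lborel. F (norm (x::'a::euclidean_space))) =
     unit_ball_vol (real DIM('a)) * real DIM('a) * integral {c..d} (\<lambda>r. r ^ (DIM('a) - 1) * F r)"
proof -
  let ?N = "DIM('a)" and ?\<omega> = "unit_ball_vol (real DIM('a))"
  \<comment> \<open>\<open>F\<close> may jump at \<open>c\<close> and \<open>d\<close>; its
    measurability comes from writing it as a function continuous on \<open>{c..d}\<close> cut off by
    an indicator.\<close>
  have F_eq: "F = (\<lambda>r. indicator {c..d} r *\<^sub>R F r)"
    using zero by (intro ext) (metis indicator_simps(1,2) scaleR_one scaleR_zero_left)
  have "(\<lambda>r. indicator {c..d} r *\<^sub>R F r) \<in> borel_measurable borel"
    using F by (intro borel_measurable_continuous_on_indicator) auto
  then have [measurable]: "F \<in> borel_measurable borel"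
    using F_eq by simp
  have "(LINT x|lborel. F (norm (x::'a))) = (LINT r|distr (lborel :: 'a measure) borel norm. F r)"
    by (subst integral_distr) auto
  also have "\<dots> = (LINT r|density lborel (\<lambda>r. ennreal (?\<omega> * real ?N * r ^ (?N - 1) * indicator {0..} r)). F r)"
    unfolding distr_lborel_norm by (intro arg_cong2[where f = lebesgue_integral] arg_cong2[where f = density]) 
      (auto simp: indicator_def)
  also have "\<dots> = (LINT r|lborel. (?\<omega> * real ?N * r ^ (?N - 1) * indicator {0..} r) *\<^sub>R F r)"
    by (subst integral_density) (auto simp: indicator_def)
  also have "\<dots> = (LINT r|lborel. ?\<omega> * real ?N * (indicator {c..d} r *\<^sub>R (r ^ (?N - 1) * F r)))"
    using c zero by (intro Bochner_Integration.integral_cong) (auto simp: indicator_def)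
  also have "\<dots> = ?\<omega> * real ?N * (LINT r:{c..d}|lborel. r ^ (?N - 1) * F r)"
    by (simp add: set_lebesgue_integral_def)
  also have "(LINT r:{c..d}|lborel. r ^ (?N - 1) * F r) = integral {c..d} (\<lambda>r. r ^ (?N - 1) * F r)"
    by (intro set_borel_integral_eq_integral borel_integrable_atLeastAtMost' continuous_intros F)
  finally show ?thesis .
qed

section \<open>Derivatives of radial functions\<close>

lemma C1_fun_has_derivative:
  assumes "C1_fun f"
  shows "(f has_derivative frechet_derivative f (at x)) (at x)"
  using assms by (simp add: C1_fun_def differentiable_on_eq_differentiable_at frechet_derivative_works[symmetric])

lemma partial_deriv_eqI:
  assumes "(f has_derivative f') (at x)"
  shows "partial_deriv j f x = f' (axis j 1)"
  unfolding partial_deriv_def frechet_derivative_at[OF assms, symmetric] ..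

lemma axis_eq_scaleR: "axis i (r::real) = r *\<^sub>R axis i 1"
  by (simp add: vec_eq_iff axis_def)

lemma norm_axis_real: "norm (axis i r :: real^'n::finite) = \<bar>r\<bar>"
  by (subst axis_eq_scaleR) (simp add: norm_axis_1)

lemma has_real_derivative_along_axis:
  fixes f :: "real^'n::finite \<Rightarrow> real"
  assumes "C1_fun f"
  shows "((\<lambda>r. f (axis i r)) has_real_derivative partial_deriv i f (axis i r)) (at r)"
proof -
  have "((\<lambda>r. r *\<^sub>R axis i 1) has_derivative (\<lambda>h. h *\<^sub>R (axis i 1 :: real^'n))) (at r)"
    by (auto intro!: derivative_eq_intros)
  then have "((\<lambda>r. f (r *\<^sub>R axis i 1)) has_derivative
      (\<lambda>h. frechet_derivative f (at (r *\<^sub>R axis i 1)) (h *\<^sub>R axis i 1))) (at r)"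
    by (rule has_derivative_compose[OF _ C1_fun_has_derivative[OF assms]])
  moreover have "linear (frechet_derivative f (at (r *\<^sub>R axis i 1)))"
    using C1_fun_has_derivative[OF assms] by (rule has_derivative_linear)
  ultimately show ?thesis
    by (subst (1 2) axis_eq_scaleR)
      (simp add: has_field_derivative_def partial_deriv_def linear_cmul mult_commute_abs)
qed

lemma continuous_on_axis [continuous_intros]:
  "continuous_on S f \<Longrightarrow> continuous_on S (\<lambda>x. axis i (f x :: real))"
  by (subst axis_eq_scaleR) (intro continuous_intros)

lemma has_derivative_radial:
  fixes F :: "real \<Rightarrow> real" and x :: "real^'n::finite"
  assumes "(F has_real_derivative F') (at (norm x))" and "x \<noteq> 0"
  shows "((\<lambda>y. F (norm y)) has_derivative (\<lambda>h. F' * (h \<bullet> x) / norm x)) (at x)"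
proof -
  have "(norm has_derivative (\<lambda>h. h \<bullet> sgn x)) (at x)"
    using assms(2) by (rule has_derivative_norm)
  then have "((\<lambda>y. F (norm y)) has_derivative (\<lambda>h. F' * (h \<bullet> sgn x))) (at x)"
    using has_derivative_compose assms(1)[unfolded has_field_derivative_def] by blast
  then show ?thesis
    by (simp add: sgn_div_norm divide_inverse mult_ac)
qed

lemma inner_axis_one: "axis j 1 \<bullet> x = (x :: real^'n::finite) $ j"
  by (simp add: inner_axis')

text \<open>Away from 0 the gradient is \<open>(F' r / r)\<close> times the position vector. The
  product rule in each coordinate and the fact that the squared coordinates sum to
  \<open>r\<^sup>2\<close> give the formula.\<close>

lemma laplacian_radial:
  fixes F F' :: "real \<Rightarrow> real" and x :: "real^'n::finite"
  assumes F: "\<And>r. 0 < r \<Longrightarrow> (F has_real_derivative F' r) (at r)"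
    and F': "(F' has_real_derivative F'') (at (norm x))" and x: "x \<noteq> 0"
  shows "laplacian (\<lambda>y. F (norm y)) x = F'' + (real CARD('n) - 1) * F' (norm x) / norm x"
proof -
  let ?k = "\<lambda>r. F' r / r" and ?r = "norm x"
  define \<kappa> where "\<kappa> = (F'' * ?r - F' ?r) / ?r\<^sup>2"
  have k: "(?k has_real_derivative \<kappa>) (at ?r)"
    using x by (auto intro!: derivative_eq_intros F' simp: \<kappa>_def power2_eq_square)
  have 1: "partial_deriv j (\<lambda>y. F (norm y)) y = ?k (norm y) * y $ j" if "y \<noteq> 0" for j and y :: "real^'n"
    using partial_deriv_eqI[OF has_derivative_radial[OF F that]] that by (simp add: inner_axis_one)
  have 2: "partial_deriv j (partial_deriv j (\<lambda>y. F (norm y))) x = ?k ?r + \<kappa> * (x $ j * x $ j) / ?r" for j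
  proof -
    have "((\<lambda>y. ?k (norm y) * y $ j) has_derivative (\<lambda>h. ?k ?r * h $ j + \<kappa> * (h \<bullet> x) / ?r * x $ j)) (at x)"
      by (intro has_derivative_mult has_derivative_radial[OF k x] bounded_linear_imp_has_derivative bounded_linear_vec_nth)
    then have "(partial_deriv j (\<lambda>y. F (norm y)) has_derivative
        (\<lambda>h. ?k ?r * h $ j + \<kappa> * (h \<bullet> x) / ?r * x $ j)) (at x)"
      by (rule has_derivative_transform_within_open[of _ _ _ _ "- {0}"]) (use x 1 in auto)
    from partial_deriv_eqI[OF this, of j] show ?thesis
      by (simp add: inner_axis_one)
  qed
  have "(\<Sum>j\<in>UNIV. x $ j * x $ j) = ?r\<^sup>2"
    by (simp add: power2_norm_eq_inner inner_vec_def)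
  then have "laplacian (\<lambda>y. F (norm y)) x = real CARD('n) * ?k ?r + \<kappa> * ?r\<^sup>2 / ?r"
    unfolding laplacian_def 2 by (simp add: sum.distrib sum_divide_distrib[symmetric] sum_distrib_left[symmetric])
  also have "\<dots> = F'' + (real CARD('n) - 1) * F' ?r / ?r"
    using x by (simp add: \<kappa>_def field_simps power2_eq_square)
  finally show ?thesis .
qed

text \<open>\<open>V\<close> vanishes near 0, so the singularity of the norm does no harm. At
  \<open>x = 0\<close> the formulas are read with division by zero giving 0.\<close>

lemma partial_deriv_radial:
  fixes V V' :: "real \<Rightarrow> real" and x :: "real^'n::finite"
  assumes V: "\<And>r. (V has_real_derivative V' r) (at r)" and c: "0 < c" "\<And>r. r \<le> c \<Longrightarrow> V r = 0"
  shows "((\<lambda>y. V (norm y)) has_derivative (\<lambda>h. V' (norm x) * (h \<bullet> x) / norm x)) (at x)"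
    and "partial_deriv j (\<lambda>y. V (norm y)) x = V' (norm x) * x $ j / norm x"
proof -
  show der: "((\<lambda>y. V (norm y)) has_derivative (\<lambda>h. V' (norm x) * (h \<bullet> x) / norm x)) (at x)"
  proof (cases "x = 0")
    case True
    have "((\<lambda>y. V (norm y)) has_derivative (\<lambda>h. 0)) (at x)"
      by (rule has_derivative_transform_within_open[OF has_derivative_const[of 0], of "ball 0 c"])
        (use True c in auto)
    then show ?thesis
      using True by simp
  qed (rule has_derivative_radial[OF V])
  show "partial_deriv j (\<lambda>y. V (norm y)) x = V' (norm x) * x $ j / norm x"
    using partial_deriv_eqI[OF der] by (simp add: inner_axis_one)
qed

text \<open>At \<open>c\<close> and \<open>d\<close> the function is known to vanish on one side
  only, but one side already determines the derivative.\<close>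

lemma derivative_zero_outside:
  fixes V :: "real \<Rightarrow> real"
  assumes "(V has_real_derivative D) (at r)" "\<And>x. x \<notin> {c<..<d} \<Longrightarrow> V x = 0" "r \<notin> {c<..<d}" "c < d"
  shows "D = 0"
proof (cases "r \<le> c")
  case True
  have "((\<lambda>_. 0) has_real_derivative D) (at r within {..r})"
    by (rule has_field_derivative_transform_within[OF has_field_derivative_at_within[OF assms(1)], of 1])
      (use True assms(2) in auto)
  moreover have "at r within {..r} \<noteq> bot"
    by (simp add: at_within_Iic_at_left)
  ultimately show ?thesis
    using has_field_derivative_unique[of "\<lambda>_. 0" D r "{..r}" 0] by simp
next
  case False
  have "((\<lambda>_. 0) has_real_derivative D) (at r within {r..})"
    by (rule has_field_derivative_transform_within[OF has_field_derivative_at_within[OF assms(1)], of 1])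
      (use False assms in auto)
  then show ?thesis
    using has_field_derivative_unique[of "\<lambda>_. 0" D r "{r..}" 0] by (simp add: at_within_Ici_at_right)
qed

text \<open>Stability is tested with \<open>V (norm x)\<close>, supported in an annulus outside a
  ball containing \<open>K\<close>. Its gradient has length \<open>\<bar>V' (norm x)\<bar>\<close>,
  and polar coordinates turn the integral into a positive multiple of the one-dimensional
  one.\<close>

lemma radial_stability:
  fixes K :: "(real^'n::finite) set" and V V' G :: "real \<Rightarrow> real"
  assumes stable: "\<And>v. C1_fun v \<Longrightarrow> compact (closure {x. v x \<noteq> 0}) \<Longrightarrow> closure {x. v x \<noteq> 0} \<subseteq> - K \<Longrightarrow>
          (LINT x|lborel. (norm (grad v x))\<^sup>2 - G (norm x) * (v x)\<^sup>2) \<ge> 0"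
    and K: "\<And>x. x \<in> K \<Longrightarrow> norm x \<le> R" and c: "R < c" "0 < c" "c < d"
    and V: "\<And>r. (V has_real_derivative V' r) (at r)" and V': "continuous_on UNIV V'"
    and zero: "\<And>r. r \<notin> {c<..<d} \<Longrightarrow> V r = 0"
    and G: "continuous_on {c..d} G"
  shows "integral {c..d} (\<lambda>r. r ^ (CARD('n) - 1) * ((V' r)\<^sup>2 - G r * (V r)\<^sup>2)) \<ge> 0"
proof -
  define v where "v x = V (norm x)" for x :: "real^'n"
  have zero': "V' r = 0" if "r \<notin> {c<..<d}" for r
    using derivative_zero_outside[OF V zero that c(3)] .
  have pd: "partial_deriv j v x = V' (norm x) * x $ j / norm x" for j x
    unfolding v_def using partial_deriv_radial(2)[OF V c(2)] zero by simp
  have "C1_fun v"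
    unfolding C1_fun_def
  proof (intro conjI allI)
    show "v differentiable_on UNIV"
      unfolding v_def using partial_deriv_radial(1)[OF V c(2)] zero
      by (auto simp: differentiable_on_eq_differentiable_at intro: differentiableI)
    fix j
    \<comment> \<open>\<open>V'\<close> vanishes up to \<open>c\<close>, so the denominator
      \<open>norm x\<close> may be replaced by \<open>max c (norm x)\<close>, which makes continuity
      at 0 visible.\<close>
    have "partial_deriv j v = (\<lambda>x. V' (norm x) * x $ j / max c (norm x))"
      using zero' by (auto simp: pd max_def)
    moreover have "continuous_on UNIV (\<lambda>x::real^'n. V' (norm x) * x $ j / max c (norm x))"
      using c by (intro continuous_intros continuous_on_compose2[OF V']) auto
    ultimately show "continuous_on UNIV (partial_deriv j v)"
      by simp
  qed
  moreover have sub: "closure {x. v x \<noteq> 0} \<subseteq> cball 0 d - ball 0 c"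
  proof (rule closure_minimal)
    show "{x. v x \<noteq> 0} \<subseteq> cball 0 d - ball 0 c"
    proof
      fix x :: "real^'n" assume "x \<in> {x. v x \<noteq> 0}"
      then have "norm x \<in> {c<..<d}"
        using zero[of "norm x"] by (auto simp: v_def)
      then show "x \<in> cball 0 d - ball 0 c"
        by simp
    qed
  qed (simp add: closed_Diff)
  moreover have "compact (closure {x. v x \<noteq> 0})"
    using sub by (meson Diff_subset bounded_cball bounded_subset closed_closure compact_eq_bounded_closed subset_trans)
  moreover have "cball 0 d - ball 0 c \<subseteq> - K"
    using K c by fastforce
  ultimately have "0 \<le> (LINT x|lborel. (norm (grad v x))\<^sup>2 - G (norm x) * (v x)\<^sup>2)"
    by (intro stable) auto
  also have "(\<lambda>x. (norm (grad v x))\<^sup>2 - G (norm x) * (v x)\<^sup>2) =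
      (\<lambda>x::real^'n. (V' (norm x))\<^sup>2 - G (norm x) * (V (norm x))\<^sup>2)"
  proof
    fix x :: "real^'n"
    have "grad v x = (V' (norm x) / norm x) *\<^sub>R x"
      by (simp add: grad_def pd vec_eq_iff)
    then have "(norm (grad v x))\<^sup>2 = (V' (norm x))\<^sup>2"
      using zero'[of 0] c by (cases "x = 0") (auto simp: power_mult_distrib power_divide)
    then show "(norm (grad v x))\<^sup>2 - G (norm x) * (v x)\<^sup>2 = (V' (norm x))\<^sup>2 - G (norm x) * (V (norm x))\<^sup>2"
      by (simp add: v_def)
  qed
  also have "(LINT x|lborel. (V' (norm (x::real^'n)))\<^sup>2 - G (norm x) * (V (norm x))\<^sup>2) =
      unit_ball_vol (real DIM(real^'n)) * real DIM(real^'n) *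
      integral {c..d} (\<lambda>r. r ^ (DIM(real^'n) - 1) * ((V' r)\<^sup>2 - G r * (V r)\<^sup>2))"
  proof (rule integral_lborel_norm)
    have "continuous_on {c..d} V"
      using V by (meson DERIV_isCont continuous_at_imp_continuous_on)
    then show "continuous_on {c..d} (\<lambda>r. (V' r)\<^sup>2 - G r * (V r)\<^sup>2)"
      by (intro continuous_intros G continuous_on_subset[OF V']) auto
    show "(V' r)\<^sup>2 - G r * (V r)\<^sup>2 = 0" if "r \<notin> {c..d}" for r
    proof -
      have "r \<notin> {c<..<d}"
        using that by auto
      then show ?thesis
        by (simp add: zero zero')
    qed
  qed (use c in simp)
  finally have "0 \<le> unit_ball_vol (real CARD('n)) * real CARD('n) *
      integral {c..d} (\<lambda>r. r ^ (CARD('n) - 1) * ((V' r)\<^sup>2 - G r * (V r)\<^sup>2))"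
    by simp
  moreover have "0 < unit_ball_vol (real CARD('n)) * real CARD('n)"
    by simp
  ultimately show ?thesis
    by (simp only: zero_le_mult_iff) linarith
qed

text \<open>The pairing of the linearised equation with \<open>z\<close> costs only the boundary term
  \<open>r\<^bsup>N-1\<^esup> z z' \<eta>\<^sup>2\<close>, which vanishes; the potential \<open>(N - 1) / r\<^sup>2\<close> comes from differentiating \<open>(N - 1) z / r\<close>.\<close>

lemma linearised_energy:
  fixes z q q' G \<eta> \<eta>' :: "real \<Rightarrow> real"
  assumes c: "0 < c" "c < d" and N: "N \<ge> 1"
    and z: "\<And>r. (z has_real_derivative q r) (at r)" and q: "\<And>r. 0 < r \<Longrightarrow> (q has_real_derivative q' r) (at r)"
    and eq: "\<And>r. 0 < r \<Longrightarrow> q' r = - G r * z r - (real N - 1) * (q r / r - z r / r\<^sup>2)"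
    and \<eta>: "\<And>r. (\<eta> has_real_derivative \<eta>' r) (at r)" and \<eta>': "continuous_on UNIV \<eta>'" and "\<eta> c = 0" "\<eta> d = 0"
    and q_cont: "continuous_on {c..d} q" and G: "continuous_on {c..d} G"
  shows "integral {c..d} (\<lambda>r. r ^ (N - 1) * ((\<eta>' r * z r + \<eta> r * q r)\<^sup>2 - G r * (\<eta> r * z r)\<^sup>2)) =
    integral {c..d} (\<lambda>r. r ^ (N - 1) * (z r)\<^sup>2 * (\<eta>' r)\<^sup>2 - (real N - 1) * (r ^ (N - 1) * (z r)\<^sup>2) / r\<^sup>2 * (\<eta> r)\<^sup>2)"
    (is "integral _ ?A = integral _ ?B")
proof -
  define P where "P r = r ^ (N - 1) * z r * q r * (\<eta> r)\<^sup>2" for r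
  define P' where "P' r = ?A r - ?B r" for r
  have z_cont: "continuous_on {c..d} z" and \<eta>_cont: "continuous_on {c..d} \<eta>"
    using z \<eta> by (meson DERIV_isCont continuous_at_imp_continuous_on)+
  have A: "?A integrable_on {c..d}" and B: "?B integrable_on {c..d}"
    using c by (auto intro!: integrable_continuous_real continuous_intros z_cont \<eta>_cont q_cont G
        continuous_on_subset[OF \<eta>'])
  have "(P has_real_derivative P' r) (at r)" if r: "0 < r" for r
  proof -
    have pow: "((\<lambda>r. r ^ (N - 1)) has_real_derivative (real N - 1) * r ^ (N - 1) / r) (at r)"
    proof (cases "N = 1")
      case False
      then have "r ^ (N - 1) = r ^ (N - 1 - Suc 0) * r"
        using N by (metis One_nat_def Suc_diff_Suc diff_Suc_1 le_neq_implies_less power_Suc2 diff_zero Suc_diff_diff)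
      then show ?thesis
        using r N by (auto intro!: derivative_eq_intros)
    qed auto
    have "(P has_real_derivative
        (((real N - 1) * r ^ (N - 1) / r * z r + q r * r ^ (N - 1)) * q r + q' r * (r ^ (N - 1) * z r)) * (\<eta> r)\<^sup>2 +
        (2 * \<eta> r * \<eta>' r) * (r ^ (N - 1) * z r * q r)) (at r)"
      unfolding P_def using DERIV_power[OF \<eta>, of 2]
      by (intro DERIV_mult pow z q[OF r]) (simp add: mult_ac)
    also have "(((real N - 1) * r ^ (N - 1) / r * z r + q r * r ^ (N - 1)) * q r + q' r * (r ^ (N - 1) * z r)) * (\<eta> r)\<^sup>2 +
        (2 * \<eta> r * \<eta>' r) * (r ^ (N - 1) * z r * q r) = P' r"
      unfolding P'_def eq[OF r] using r by (simp add: field_simps power2_eq_square)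
    finally show ?thesis .
  qed
  then have "(P' has_integral P d - P c) {c..d}"
    using c by (intro fundamental_theorem_of_calculus)
      (auto simp: has_real_derivative_iff_has_vector_derivative[symmetric] intro: has_field_derivative_at_within)
  then have "integral {c..d} P' = 0"
    using assms by (simp add: P_def integral_unique)
  then show ?thesis
    unfolding P'_def using integral_diff[OF A B] by simp
qed

theorem corollary1p3:
  fixes g :: "real \<Rightarrow> real" and u :: "real^'n::finite \<Rightarrow> real"
  assumes "CARD('n) \<ge> 2"
    and "g C1_differentiable_on UNIV"
    and "radial u"
    and "classical_solution g u"
    and "stable_outside_compact g u"
  shows "condition_L CARD('n) (radial_profile u) \<or> condition_S CARD('n) (radial_profile u)"
proof -
  let ?N = "CARD('n)"
  define i :: 'n where "i = undefined"
  \<comment> \<open>The restriction of \<open>u\<close> to a whole coordinate axis, arbitrarily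
    chosen, is differentiable at 0 and at negative \<open>r\<close> too.\<close>
  define w where "w r = u (axis i r)" for r
  define z where "z r = partial_deriv i u (axis i r)" for r
  define q where "q r = partial_deriv i (partial_deriv i u) (axis i r)" for r
  have C1: "C1_fun u" "C1_fun (partial_deriv i u)"
    and pde: "- laplacian u x = g (u x)" for x
    using assms(4) by (auto simp: classical_solution_def C2_fun_def)
  have w: "(w has_real_derivative z r) (at r)" and z: "(z has_real_derivative q r) (at r)" for r
    unfolding w_def z_def q_def by (intro has_real_derivative_along_axis C1)+
  have w_cont: "continuous_on S w" and z_cont: "continuous_on S z" for S
    using w z by (meson DERIV_isCont continuous_at_imp_continuous_on)+
  have q_cont: "continuous_on S q" for S
  proof -
    have "continuous_on UNIV (partial_deriv i (partial_deriv i u))"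
      using C1(2) by (simp add: C1_fun_def)
    then show ?thesis
      unfolding q_def by (rule continuous_on_compose2) (auto intro!: continuous_intros)
  qed
  have u_eq: "u = (\<lambda>x. w (norm x))"
  proof
    fix x :: "real^'n"
    have "norm x = norm (axis i (norm x) :: real^'n)"
      by (simp add: norm_axis_real)
    then show "u x = w (norm x)"
      using assms(3) unfolding radial_def w_def by blast
  qed
  obtain g' where g: "\<And>y. (g has_real_derivative g' y) (at y)" and g': "continuous_on UNIV g'"
    using assms(2) by (auto simp: C1_differentiable_on_def has_real_derivative_iff_has_vector_derivative)
  have deriv_g: "deriv g = g'"
    using g by (auto intro: DERIV_imp_deriv)
  have ode: "q r = - g (w r) - (real ?N - 1) * (z r / r)" if "0 < r" for r
  proof -
    have x: "norm (axis i r :: real^'n) = r" "axis i r \<noteq> (0 :: real^'n)"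
      using that by (auto simp: norm_axis_real)
    have "laplacian u (axis i r) = q r + (real ?N - 1) * z r / r"
      unfolding u_eq using laplacian_radial[OF w z x(2)] x(1) by simp
    then show ?thesis
      using pde[of "axis i r"] by (simp add: w_def)
  qed
  \<comment> \<open>The third derivative of the profile for \<open>r > 0\<close>. As
    \<open>u\<close> is only assumed \<open>C\<^sup>2\<close>, it comes from differentiating the
    right-hand side of \<open>ode\<close>, where \<open>g\<close> is
    \<open>C\<^sup>1\<close>.\<close>
  define q' where "q' r = - g' (w r) * z r - (real ?N - 1) * (q r / r - z r / r\<^sup>2)" for r
  have q: "(q has_real_derivative q' r) (at r)" if r: "0 < r" for r
  proof -
    have "((\<lambda>r. - g (w r) - (real ?N - 1) * (z r / r)) has_real_derivative q' r) (at r)"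
      using r by (auto intro!: derivative_eq_intros DERIV_chain2[OF g w] z simp: q'_def field_simps power2_eq_square)
    then show ?thesis
      by (rule has_field_derivative_transform_within_open[of _ _ _ "{0<..}"]) (use r ode in auto)
  qed
  obtain K :: "(real^'n) set" where K: "compact K" and stable: "\<And>v. C1_fun v \<Longrightarrow> compact (closure {x. v x \<noteq> 0}) \<Longrightarrow>
      closure {x. v x \<noteq> 0} \<subseteq> - K \<Longrightarrow> (LINT x|lborel. (norm (grad v x))\<^sup>2 - g' (w (norm x)) * (v x)\<^sup>2) \<ge> 0"
    using assms(5) unfolding stable_outside_compact_def deriv_g by (subst (asm) u_eq) auto
  obtain R where R: "R > 0" "\<And>x. x \<in> K \<Longrightarrow> norm x \<le> R"
    using compact_imp_bounded[OF K] bounded_pos by metis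
  interpret radial_weight w z q ?N R
  proof unfold_locales
    show "0 \<le> R" "0 \<le> sqrt (real ?N - 1)" "?N \<ge> 2"
      using R assms(1) by auto
    show "continuous_on {R<..} (\<lambda>x. x ^ (?N - 1) * (z x)\<^sup>2)" "continuous_on {0<..} q"
      by (intro continuous_intros z_cont q_cont)+
    show "0 \<le> x ^ (?N - 1) * (z x)\<^sup>2" if "R < x" for x
      using that R by simp
    show "(w has_real_derivative z x) (at x)" "(z has_real_derivative q x) (at x)" for x
      by (fact w z)+
    fix c d \<eta> \<eta>' assume c: "R < c" "c < d" and \<eta>: "\<And>x. (\<eta> has_real_derivative \<eta>' x) (at x)"
      and \<eta>': "continuous_on UNIV \<eta>'" and zero: "\<And>x. x \<notin> {c<..<d} \<Longrightarrow> \<eta> x = 0"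
    have G: "continuous_on {c..d} (\<lambda>r. g' (w r))"
      by (intro continuous_on_compose2[OF g'] w_cont) auto
    have \<eta>_cont: "continuous_on UNIV \<eta>"
      using \<eta> by (meson DERIV_isCont continuous_at_imp_continuous_on)
    \<comment> \<open>The test function is \<open>\<eta> * z\<close>, which is
      \<open>C\<^sup>1\<close> because \<open>z\<close> has the continuous derivative
      \<open>q\<close>.\<close>
    have "0 \<le> integral {c..d} (\<lambda>r. r ^ (?N - 1) * ((\<eta>' r * z r + \<eta> r * q r)\<^sup>2 - g' (w r) * (\<eta> r * z r)\<^sup>2))"
    proof (rule radial_stability[OF stable R(2) c(1) _ c(2) _ _ _ G])
      show "((\<lambda>r. \<eta> r * z r) has_real_derivative \<eta>' r * z r + \<eta> r * q r) (at r)" for r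
        using DERIV_mult[OF \<eta> z] by (simp add: add.commute mult.commute)
      show "continuous_on UNIV (\<lambda>r. \<eta>' r * z r + \<eta> r * q r)"
        by (intro continuous_intros \<eta>' \<eta>_cont z_cont q_cont)
    qed (use c R zero in auto)
    also have "\<dots> = integral {c..d} (\<lambda>r. r ^ (?N - 1) * (z r)\<^sup>2 * (\<eta>' r)\<^sup>2 -
        (real ?N - 1) * (r ^ (?N - 1) * (z r)\<^sup>2) / r\<^sup>2 * (\<eta> r)\<^sup>2)"
      using c R zero by (intro linearised_energy[OF _ _ _ z q _ \<eta> \<eta>' _ _ q_cont G]) (auto simp: q'_def)
    finally show "0 \<le> integral {c..d} (\<lambda>x. x ^ (?N - 1) * (z x)\<^sup>2 * (\<eta>' x)\<^sup>2 -
        (sqrt (real ?N - 1))\<^sup>2 * (x ^ (?N - 1) * (z x)\<^sup>2) / x\<^sup>2 * (\<eta> x)\<^sup>2)"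
      using assms(1) by simp
  qed
  have profile: "radial_profile u r = w r" if "r \<ge> 1" for r
  proof -
    have "norm (axis i r :: real^'n) = r"
      using that by (simp add: norm_axis_real)
    then have "norm (SOME x :: real^'n. norm x = r) = r"
      by (rule someI)
    then show ?thesis
      unfolding radial_profile_def by (simp add: u_eq)
  qed
  show ?thesis
    using condition_L_or_S condition_L_cong[of "radial_profile u" w, OF profile]
      condition_S_cong[of "radial_profile u" w, OF profile] by simp
qed

end
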